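(* Let $(f,g)$ and $(f',g')$ be models with representation dimensions $m$ and $m'$ respectively (possibly different), such that $M_{f,f}=\mathbb E_{x\sim p_x}[f(x)f(x)^\top]$ and $L$ have rank $m$, and $M_{f',f'}$ and $L'$ have rank $m'$. Let $\mu_1\ge\dots\ge\mu_m>0$ be the nonzero eigenvalues of $M_{u,u}=\mathbb E_{x\sim p_x}[u(x)u(x)^\top]=L^\top M_{f,f}L$. Let $\rho_1\ge\dots\ge\rho_{\min(m,m')}$ be the singular values of $(LL^\top)^{-1/2}LL'^\top(L'L'^\top)^{-1/2}$ and $\tilde\rho_1\ge\dots\ge\tilde\rho_{\min(m,m')}$ the singular values of $M_{f,f}^{-1/2}M_{f,f'}M_{f',f'}^{-1/2}$, where $M_{f,f'}=\mathbb E_{x\sim p_x}[f(x)f'(x)^\top]$; set $\rho_i=\tilde\rho_i=0$ for $m'<i\le m$ if $m'<m$. Then $$\sum_{i=1}^m(1-\rho_i^2)\mu_i\le\mathbb E_{x\sim p_x}\|u(x)-u'(x)\|^2\quad\text{and}\quad\sum_{i=1}^m(1-\tilde\rho_i^2)\mu_i\le\mathbb E_{x\sim p_x}\|u(x)-u'(x)\|^2.$$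
   Context: Models: pairs $(f,g)$ with $f:\mathcal X\to\mathbb R^m$, $g:\mathcal Y\to\mathbb R^m$, $\mathcal Y=\{y_1,\dots,y_k\}$, $\sum_y g(y)=0$ (and similarly $(f',g')$ with values in $\mathbb R^{m'}$, $\sum_y g'(y)=0$). $L=(g(y_1)\ \cdots\ g(y_k))\in\mathbb R^{m\times k}$, $L'=(g'(y_1)\ \cdots\ g'(y_k))\in\mathbb R^{m'\times k}$. Logits $u(x)=L^\top f(x)\in\mathbb R^k$, $u'(x)=L'^\top f'(x)$. $p_x$ is the data distribution on $\mathcal X$. *)

theory Defs
  imports "HOL-Probability.Probability" "Jordan_Normal_Form.DL_Rank" "Jordan_Normal_Form.Char_Poly"
begin

(* Matrix / vector conventions: Jordan_Normal_Form types 'a mat, 'a vec with explicit dimensions.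
   The label set Y = {y_1..y_k} is identified with the indices {0..<k}. *)

definition sym_mat :: "real mat \<Rightarrow> bool" where
  "sym_mat A \<longleftrightarrow> A\<^sup>T = A"

definition psd_mat :: "real mat \<Rightarrow> bool" where
  "psd_mat A \<longleftrightarrow> square_mat A \<and> sym_mat A \<and>
     (\<forall>v \<in> carrier_vec (dim_row A). v \<bullet> (A *\<^sub>v v) \<ge> 0)"

definition inv_mat :: "real mat \<Rightarrow> real mat" where
  "inv_mat A = (THE B. B \<in> carrier_mat (dim_row A) (dim_row A) \<and> inverts_mat A B \<and> inverts_mat B A)"

definition psd_sqrt :: "real mat \<Rightarrow> real mat" where
  "psd_sqrt A = (THE S. S \<in> carrier_mat (dim_row A) (dim_row A) \<and> psd_mat S \<and> S * S = A)"

definition inv_sqrt :: "real mat \<Rightarrow> real mat" where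
  "inv_sqrt A = psd_sqrt (inv_mat A)"

definition eigvals_desc :: "real mat \<Rightarrow> real list" where
  "eigvals_desc A = (THE xs. length xs = dim_row A \<and> sorted (rev xs) \<and>
                      char_poly A = (\<Prod>x\<leftarrow>xs. [:- x, 1:]))"

text \<open>i-th singular value (0-based, non-increasing) of a matrix; the min(rows, cols)
  singular values are the square roots of the largest eigenvalues of A^T A; for indices
  i \<ge> min(rows, cols) the value is set to 0 (the paper's padding convention).\<close>
definition sing_val :: "real mat \<Rightarrow> nat \<Rightarrow> real" where
  "sing_val A i = (if i < min (dim_row A) (dim_col A)
                    then sqrt (eigvals_desc (A\<^sup>T * A) ! i) else 0)"

definition moment_mat :: "'a measure \<Rightarrow> nat \<Rightarrow> nat \<Rightarrow> ('a \<Rightarrow> real vec) \<Rightarrow> ('a \<Rightarrow> real vec) \<Rightarrow> real mat" where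
  "moment_mat M n n' a b = mat n n' (\<lambda>(i,j). integral\<^sup>L M (\<lambda>x. a x $ i * b x $ j))"

text \<open>Model (f,g) with representation dimension m and k labels: f maps into R^m, the unembedding
  matrix L = (g(y_1) ... g(y_k)) is m x k, with sum_y g(y) = 0 (rows of L sum to zero).\<close>
definition is_model :: "'a measure \<Rightarrow> nat \<Rightarrow> nat \<Rightarrow> ('a \<Rightarrow> real vec) \<Rightarrow> real mat \<Rightarrow> bool" where
  "is_model M m k f L \<longleftrightarrow> L \<in> carrier_mat m k \<and>
     (\<forall>i<m. (\<Sum>j<k. L $$ (i,j)) = 0) \<and>
     (\<forall>x \<in> space M. f x \<in> carrier_vec m) \<and>
     (\<forall>i<m. (\<lambda>x. f x $ i) \<in> borel_measurable M \<and> integrable M (\<lambda>x. (f x $ i)\<^sup>2))"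

definition logits :: "real mat \<Rightarrow> ('a \<Rightarrow> real vec) \<Rightarrow> 'a \<Rightarrow> real vec" where
  "logits L f x = L\<^sup>T *\<^sub>v f x"

end

(* Write R, R' for the inverse square roots of the relevant Gram matrices.

   Orthogonal projection of u(x) onto the row space of L' (first bound), respectively L2-projection
   of u onto the span of the components of f' (second bound), is a best approximation of u among
   candidates that include u'.  In both cases the approximation error has the form
   |C|^2 - |A^T C|^2 in Frobenius norm, where C^T C = M_uu and A is the matrix whose singular values
   occur in the statement: C = R L sqrt(M_uu) for the first bound and C = R^(-1) L for the second.

   A von Neumann type trace inequality then gives |A^T C|^2 <= sum_i rho_i^2 mu_i.  Rotating A and C
   to have orthogonal columns a_i, c_j of squared norms rho_i^2, mu_j, the left side is
   sum_ij <a_i,c_j>^2 = sum_ij rho_i^2 mu_j S_ij, where S is doubly substochastic by Bessel's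
   inequality, and the rearrangement inequality for such S finishes the proof.  As the columns live
   in an m-dimensional space, all weights with index at least m vanish. *)

theory Submission
  imports Defs "Jordan_Normal_Form.Schur_Decomposition"
begin

section \<open>Spectral decomposition of real symmetric matrices\<close>

text \<open>Eigenvalue lists, square roots and inverses are definite descriptions here, so nothing
  can be computed before existence and uniqueness are settled for symmetric and psd matrices. The
  mismatch of sizes shapes the rest: \<open>M_uu\<close> is \<open>k\<close> by \<open>k\<close>,
  while only \<open>m\<close> of its eigenvalues occur and \<open>A\<close> has \<open>m\<close>
  rows. Hence a factor \<open>C\<close> of \<open>M_uu\<close> with exactly \<open>m\<close> rows is
  needed. In the second bound a root of \<open>M_ff\<close> supplies it. In the first bound
  \<open>sqrt(M_uu)\<close> is compressed to coordinates in the row space of \<open>L\<close>, which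
  loses nothing because \<open>M_uu\<close> maps into that space. Both best-approximation arguments
  become an expansion of a square. The cross term of \<open>u\<close> with \<open>u'\<close> and the
  square of \<open>u'\<close> are the same for \<open>u\<close> and for its projection, so the full
  error minus the projected error is \<open>|C|^2 - |A^T C|^2\<close>, and the projected error is
  nonnegative. Full singular value decompositions are avoided: rotating on the right alone makes
  columns orthogonal and preserves Frobenius norms.\<close>

text \<open>Gram-Schmidt applied to a basis completion of \<open>v\<close> keeps \<open>v\<close> as
  its head, and the columns are then normalised. Only the direction of the first column matters for
  deflation, so the factor \<open>c\<close> stays unspecified.\<close>

lemma orthogonal_mat_with_first_col:
  fixes v :: "real vec"
  assumes v: "v \<in> carrier_vec n" and v0: "v \<noteq> 0\<^sub>v n"
  shows "\<exists>W c. W \<in> carrier_mat n n \<and> W\<^sup>T * W = 1\<^sub>m n \<and> col W 0 = c \<cdot>\<^sub>v v"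
proof -
  have n: "n \<noteq> 0" using v v0 by auto
  interpret cof_vec_space n "TYPE(real)" .
  define b where "b = basis_completion v"
  define ws where "ws = gram_schmidt n b"
  from basis_completion[OF v v0, folded b_def]
  have dist_b: "distinct b" and indep: "\<not> lin_dep (set b)" and b: "set b \<subseteq> carrier_vec n"
    and hdb: "hd b = v" and len_b: "length b = n" by auto
  from hdb len_b n obtain vs where bv: "b = v # vs" by (cases b, auto)
  from gram_schmidt_result[OF b dist_b indep refl, folded ws_def]
  have ws: "set ws \<subseteq> carrier_vec n" "corthogonal ws" "length ws = n"
    by (auto simp: len_b)
  from gram_schmidt_hd[OF v, of vs, folded bv] have hdws: "hd ws = v" unfolding ws_def .
  have ws0: "ws ! 0 = v" using hdws ws(3) n by (cases ws, auto)
  have wsc: "ws ! i \<in> carrier_vec n" if "i < n" for i using ws that by auto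
  define g where "g i = sqrt (ws ! i \<bullet> ws ! i)" for i
  have conj: "conjugate x = x" for x :: "real vec" by (rule eq_vecI) auto
  have orth: "(ws ! i \<bullet> ws ! j = 0) = (i \<noteq> j)" if "i < n" "j < n" for i j
    using corthogonalD[OF ws(2)] that ws(3) by (simp add: conj)
  have nn: "ws ! i \<bullet> ws ! i \<ge> 0" for i by (auto simp: scalar_prod_def intro: sum_nonneg)
  have gp: "g i > 0" if "i < n" for i
    using orth[OF that that] nn[of i] unfolding g_def by simp
  have gg: "g i * g i = ws ! i \<bullet> ws ! i" for i unfolding g_def using nn[of i] by simp
  define W where "W = mat n n (\<lambda>(i,j). ws ! j $ i / g j)"
  have W: "W \<in> carrier_mat n n" unfolding W_def by simp
  have colW: "col W j = (1 / g j) \<cdot>\<^sub>v (ws ! j)" if "j < n" for j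
    using that wsc[OF that] unfolding W_def by (intro eq_vecI) auto
  have "W\<^sup>T * W = 1\<^sub>m n"
  proof (rule eq_matI)
    fix i j assume "i < dim_row (1\<^sub>m n :: real mat)" "j < dim_col (1\<^sub>m n :: real mat)"
    hence i: "i < n" and j: "j < n" by auto
    have "(W\<^sup>T * W) $$ (i,j) = col W i \<bullet> col W j" using W i j by auto
    also have "\<dots> = (ws ! i \<bullet> ws ! j) / (g i * g j)"
      using colW i j wsc by (simp add: scalar_prod_smult_distrib[where n = n] smult_scalar_prod_distrib[where n = n])
    also have "\<dots> = 1\<^sub>m n $$ (i,j)"
      using orth[OF i j] gp[OF i] gg[of i] i j by (cases "i = j") auto
    finally show "(W\<^sup>T * W) $$ (i,j) = 1\<^sub>m n $$ (i,j)" .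
  qed (use W in auto)
  moreover have "col W 0 = (1 / g 0) \<cdot>\<^sub>v v" using colW[of 0] n ws0 by simp
  ultimately show ?thesis using W by blast
qed

lemma transpose_mult3:
  assumes "A \<in> carrier_mat a b" "B \<in> carrier_mat b c" "C \<in> carrier_mat c d"
  shows "(A * B * C)\<^sup>T = C\<^sup>T * B\<^sup>T * (A :: 'a :: comm_semiring_0 mat)\<^sup>T"
  using assms by (simp add: transpose_mult[where nc = d] transpose_mult[where nc = c] assoc_mult_mat[where ?n\<^sub>1 = d and ?n\<^sub>2 = c and ?n\<^sub>3 = b and ?n\<^sub>4 = a])

text \<open>Deflation along the list of roots: rotating an eigenvector for \<open>e\<close> into
  first position splits off a \<open>1\<close> by \<open>1\<close> block, and the remaining
  symmetric block has the remaining roots. The diagonal thus inherits the order of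
  \<open>es\<close>, so a sorted list yields a sorted diagonal.\<close>

lemma symmetric_diagonalization:
  fixes A :: "real mat"
  assumes "A \<in> carrier_mat n n" "A\<^sup>T = A" "char_poly A = (\<Prod>e\<leftarrow>es. [:- e, 1:])"
  shows "\<exists>U \<in> carrier_mat n n. U\<^sup>T * U = 1\<^sub>m n \<and> U\<^sup>T * A * U = mat_diag n (\<lambda>i. es ! i)"
  using assms
proof (induction es arbitrary: n A)
  case Nil
  with degree_monic_char_poly[of A n] have "n = 0" by auto
  then show ?case using Nil by (intro bexI[of _ "1\<^sub>m 0"]) (auto intro!: eq_matI simp: mat_diag_def)
next
  case (Cons e es n A)
  note A = Cons.prems(1) and sym = Cons.prems(2) and cp = Cons.prems(3)
  define n1 where "n1 = n - 1"
  have "eigenvalue A e" unfolding eigenvalue_root_char_poly[OF A] cp by simp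
  from find_eigenvector[OF A this] obtain v where v: "v \<in> carrier_vec n" and v0: "v \<noteq> 0\<^sub>v n"
    and ev: "A *\<^sub>v v = e \<cdot>\<^sub>v v" using A unfolding eigenvector_def by auto
  have n: "n = Suc n1" using v v0 unfolding n1_def by (cases n) auto
  obtain W c where W: "W \<in> carrier_mat n n" and WW: "W\<^sup>T * W = 1\<^sub>m n"
    and W0: "col W 0 = c \<cdot>\<^sub>v v"
    using orthogonal_mat_with_first_col[OF v v0] by blast
  have cW: "col W j \<in> carrier_vec n" for j using W by (metis carrier_matD(1) col_dim)
  have WT: "W\<^sup>T \<in> carrier_mat n n" using W by simp
  have WW': "W * W\<^sup>T = 1\<^sub>m n" using mat_mult_left_right_inverse[OF WT W WW] .
  define A' where "A' = W\<^sup>T * A * W"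
  have A': "A' \<in> carrier_mat n n" unfolding A'_def using A W by simp
  have symA': "A'\<^sup>T = A'" unfolding A'_def by (simp add: transpose_mult3[OF WT A W] sym)
  have sim: "similar_mat A' A" unfolding similar_mat_def
    by (rule exI[of _ "W\<^sup>T"], rule exI[of _ W], rule similar_mat_witI[of _ _ n]) (use W A A' WW WW' A'_def in auto)
  have col0: "A' $$ (i, 0) = (if i = 0 then e else 0)" if i: "i < n" for i
  proof -
    have "A' = W\<^sup>T * (A * W)" unfolding A'_def using W A by simp
    then have "A' $$ (i, 0) = col W i \<bullet> (A *\<^sub>v col W 0)" using W A i n
      by (auto simp: mult_mat_vec_def)
    also have "A *\<^sub>v col W 0 = e \<cdot>\<^sub>v col W 0"
      unfolding W0 using A v ev by (simp add: mult_mat_vec[OF A v] smult_smult_assoc mult.commute)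
    also have "col W i \<bullet> (e \<cdot>\<^sub>v col W 0) = e * (col W i \<bullet> col W 0)"
      by (rule scalar_prod_smult_distrib[OF cW cW])
    also have "col W i \<bullet> col W 0 = (W\<^sup>T * W) $$ (i, 0)" using W i n by auto
    finally show ?thesis using WW i n by simp
  qed
  define A3 where "A3 = mat n1 n1 (\<lambda>(i,j). A' $$ (Suc i, Suc j))"
  have A3: "A3 \<in> carrier_mat n1 n1" unfolding A3_def by simp
  define A1 where "A1 = mat 1 1 (\<lambda>_. e)"
  have A1: "A1 \<in> carrier_mat 1 1" unfolding A1_def by simp
  have symij: "A' $$ (i,j) = A' $$ (j,i)" if "i < n" "j < n" for i j
    using arg_cong[OF symA', of "\<lambda>M. M $$ (i,j)"] that A' by simp
  \<comment> \<open>Symmetry carries the zeros of the first column over to the first row.\<close>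
  have blk: "A' = four_block_mat A1 (0\<^sub>m 1 n1) (0\<^sub>m n1 1) A3"
  proof (rule eq_matI)
    fix i j assume "i < dim_row (four_block_mat A1 (0\<^sub>m 1 n1) (0\<^sub>m n1 1) A3)"
      "j < dim_col (four_block_mat A1 (0\<^sub>m 1 n1) (0\<^sub>m n1 1) A3)"
    hence ij: "i < n" "j < n" using A1 A3 n by auto
    show "A' $$ (i,j) = four_block_mat A1 (0\<^sub>m 1 n1) (0\<^sub>m n1 1) A3 $$ (i,j)"
      using ij n A1 A3 col0[of i] col0[of j] symij[of i j]
      by (cases i; cases j) (auto simp: A1_def A3_def)
  qed (use A' A1 A3 n in auto)
  have symA3: "A3\<^sup>T = A3" unfolding A3_def using symij n by (intro eq_matI) auto
  have "[: -e,1 :] * (\<Prod>e\<leftarrow>es. [:- e, 1:]) = char_poly A'"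
    using cp char_poly_similar[OF sim] by simp
  also have "char_poly A' = char_poly A1 * char_poly A3"
    unfolding blk by (rule char_poly_four_block_zeros_col[OF A1 _ A3]) simp
  also have "char_poly A1 = [: -e,1 :]"
    by (simp add: A1_def char_poly_defs det_def sign_def)
  finally have cp3: "char_poly A3 = (\<Prod>e\<leftarrow>es. [:- e, 1:])"
    by (metis mult_cancel_left pCons_eq_0_iff zero_neq_one)
  obtain U3 where U3: "U3 \<in> carrier_mat n1 n1" and UU3: "U3\<^sup>T * U3 = 1\<^sub>m n1"
    and UAU3: "U3\<^sup>T * A3 * U3 = mat_diag n1 (\<lambda>i. es ! i)"
    using Cons.IH[OF A3 symA3 cp3] by blast
  define B where "B = four_block_mat (1\<^sub>m 1) (0\<^sub>m 1 n1) (0\<^sub>m n1 1) U3"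
  have B: "B \<in> carrier_mat n n" unfolding B_def using U3 n
    by (metis four_block_carrier_mat one_carrier_mat plus_1_eq_Suc)
  have BT: "B\<^sup>T = four_block_mat (1\<^sub>m 1) (0\<^sub>m 1 n1) (0\<^sub>m n1 1) U3\<^sup>T"
    unfolding B_def
    by (subst transpose_four_block_mat[of _ 1 1 _ n1 _ n1]) (use U3 in auto)
  have U3T: "U3\<^sup>T \<in> carrier_mat n1 n1" using U3 by simp
  have BB: "B\<^sup>T * B = 1\<^sub>m n"
    unfolding BT unfolding B_def
    by (subst mult_four_block_mat[of _ 1 1 _ n1 _ n1 _ _ 1 _ n1]) (use U3 U3T UU3 n in auto)
  have BAB: "B\<^sup>T * A' * B = mat_diag n (\<lambda>i. (e # es) ! i)"
  proof -
    have "B\<^sup>T * A' = four_block_mat A1 (0\<^sub>m 1 n1) (0\<^sub>m n1 1) (U3\<^sup>T * A3)"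
      unfolding BT blk
      by (subst mult_four_block_mat[of _ 1 1 _ n1 _ n1 _ _ 1 _ n1]) (use U3 U3T A1 A3 n in auto)
    also have "\<dots> * B = four_block_mat A1 (0\<^sub>m 1 n1) (0\<^sub>m n1 1) (mat_diag n1 (\<lambda>i. es ! i))"
      unfolding B_def
      by (subst mult_four_block_mat[of _ 1 1 _ n1 _ n1 _ _ 1 _ n1]) (use U3 U3T A1 A3 n UAU3 in auto)
    also have "\<dots> = mat_diag n (\<lambda>i. (e # es) ! i)"
      by (rule eq_matI) (auto simp: n A1_def mat_diag_def nth_Cons' split: if_splits)
    finally show ?thesis .
  qed
  have WB: "W * B \<in> carrier_mat n n" using W B by simp
  have BTc: "B\<^sup>T \<in> carrier_mat n n" using B by simp
  have tr: "(W * B)\<^sup>T = B\<^sup>T * W\<^sup>T" by (rule transpose_mult[OF W B])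
  have "(W * B)\<^sup>T * (W * B) = B\<^sup>T * (W\<^sup>T * W) * B"
    unfolding tr using W B BTc WT by (simp add: assoc_mult_mat[where ?n\<^sub>1=n and ?n\<^sub>2=n and ?n\<^sub>3=n and ?n\<^sub>4=n])
  then have 1: "(W * B)\<^sup>T * (W * B) = 1\<^sub>m n" using WW BB B BTc by simp
  have "(W * B)\<^sup>T * A * (W * B) = B\<^sup>T * A' * B"
    unfolding tr A'_def using W B BTc WT A by (simp add: assoc_mult_mat[where ?n\<^sub>1=n and ?n\<^sub>2=n and ?n\<^sub>3=n and ?n\<^sub>4=n])
  then show ?case using BAB 1 WB by auto
qed

text \<open>The Hermitian form \<open>q\<close> of the eigenvector equals \<open>a\<close> times its
  positive squared norm \<open>s\<close>, and symmetry of the real matrix makes \<open>q\<close> its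
  own conjugate.\<close>

lemma symmetric_complex_eigenvalue_real:
  fixes A :: "real mat"
  assumes A: "A \<in> carrier_mat n n" and sym: "A\<^sup>T = A"
    and ev: "eigenvalue (map_mat complex_of_real A) a"
  shows "a \<in> \<real>"
proof -
  define B where "B = map_mat complex_of_real A"
  have B: "B \<in> carrier_mat n n" unfolding B_def using A by simp
  obtain v where v: "v \<in> carrier_vec n" "v \<noteq> 0\<^sub>v n" "B *\<^sub>v v = a \<cdot>\<^sub>v v"
    using find_eigenvector[OF B] ev B unfolding B_def[symmetric] eigenvector_def carrier_mat_def by blast
  have Bv: "(\<Sum>j<n. complex_of_real (A $$ (i,j)) * v $ j) = a * v $ i" if "i < n" for i
  proof -
    have "(B *\<^sub>v v) $ i = a * v $ i" using v that by simp
    then show ?thesis using that B A v(1)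
      by (simp add: scalar_prod_def B_def lessThan_atLeast0)
  qed
  have symij: "A $$ (i,j) = A $$ (j,i)" if "i < n" "j < n" for i j
    using arg_cong[OF sym, of "\<lambda>M. M $$ (i,j)"] that A by simp
  define q where "q = (\<Sum>i<n. cnj (v $ i) * (\<Sum>j<n. complex_of_real (A $$ (i,j)) * v $ j))"
  define s where "s = (\<Sum>i<n. (cmod (v $ i))\<^sup>2)"
  have "q = (\<Sum>i<n. cnj (v $ i) * (a * v $ i))" unfolding q_def using Bv by simp
  also have "\<dots> = a * of_real s" unfolding s_def of_real_sum sum_distrib_left
    by (intro sum.cong refl) (simp only: complex_norm_square mult_ac)
  finally have q: "q = a * of_real s" .
  have "cnj q = (\<Sum>i<n. \<Sum>j<n. v $ i * complex_of_real (A $$ (i,j)) * cnj (v $ j))"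
    unfolding q_def by (simp add: sum_distrib_left mult_ac)
  also have "\<dots> = (\<Sum>j<n. \<Sum>i<n. v $ i * complex_of_real (A $$ (i,j)) * cnj (v $ j))"
    by (rule sum.swap)
  also have "\<dots> = q" unfolding q_def sum_distrib_left
    by (intro sum.cong refl) (use symij in \<open>simp add: mult_ac\<close>)
  finally have cq: "cnj q = q" .
  have "s > 0"
  proof -
    obtain i where "i < n" "v $ i \<noteq> 0"
    proof (rule ccontr)
      assume "\<not> thesis"
      then have "v = 0\<^sub>v n" using that v(1) by (intro eq_vecI) auto
      then show False using v(2) by blast
    qed
    then show ?thesis unfolding s_def by (intro sum_pos2[of _ i]) auto
  qed
  then have "cnj a = a" using cq unfolding q by simp
  then show ?thesis by (simp add: Reals_cnj_iff)
qed

text \<open>The characteristic polynomial splits over the complex numbers with real roots only, and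
  the factorisation descends because embedding real polynomials into complex ones is
  injective.\<close>

lemma symmetric_char_poly_splits:
  fixes A :: "real mat"
  assumes A: "A \<in> carrier_mat n n" and sym: "A\<^sup>T = A"
  shows "\<exists>es. char_poly A = (\<Prod>e\<leftarrow>es. [:- e, 1:]) \<and> length es = n"
proof -
  define B where "B = map_mat complex_of_real A"
  have B: "B \<in> carrier_mat n n" unfolding B_def using A by simp
  from char_poly_factorized[OF B] obtain as where
    as: "char_poly B = (\<Prod>a\<leftarrow>as. [:- a, 1:])" and len: "length as = n" by blast
  have "a \<in> \<real>" if "a \<in> set as" for a
  proof -
    have "poly (char_poly B) a = 0" unfolding as using that
      by (auto simp: poly_prod_list prod_list_zero_iff image_iff)
    then show ?thesis
      using symmetric_complex_eigenvalue_real[OF A sym] eigenvalue_root_char_poly[OF B]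
      unfolding B_def by blast
  qed
  then have as_eq: "as = map complex_of_real (map Re as)" by (induction as) auto
  define es where "es = map Re as"
  interpret h: map_poly_inj_idom_hom complex_of_real ..
  have "map_poly complex_of_real (char_poly A) = char_poly B"
    unfolding B_def by (rule of_real_hom.char_poly_hom[OF A, symmetric])
  also have "\<dots> = (\<Prod>e\<leftarrow>es. [:- complex_of_real e, 1:])"
    unfolding as by (subst as_eq) (simp only: es_def map_map o_def)
  also have "\<dots> = map_poly complex_of_real (\<Prod>e\<leftarrow>es. [:- e, 1:])"
    unfolding h.hom_prod_list map_map o_def
    by (intro arg_cong[of _ _ prod_list] map_cong refl) (simp add: map_poly_pCons)
  finally have "char_poly A = (\<Prod>e\<leftarrow>es. [:- e, 1:])"
    by (rule h.injectivity)
  moreover have "length es = n" using len unfolding es_def by simp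
  ultimately show ?thesis by blast
qed

text \<open>The product determines the multiset of roots, and a sorted list is determined by its
  multiset. This is the uniqueness half needed for \<open>eigvals_desc\<close>.\<close>

lemma linear_factors_unique:
  fixes xs ys :: "'a :: linordered_idom list"
  assumes eq: "(\<Prod>x\<leftarrow>xs. [:- x, 1:]) = (\<Prod>x\<leftarrow>ys. [:- x, 1:])"
    and "sorted (rev xs)" "sorted (rev ys)"
  shows "xs = ys"
proof -
  have "proots (\<Prod>x\<leftarrow>zs. [:- x, 1:]) = mset zs" for zs :: "'a list"
  proof (induction zs)
    case (Cons z zs)
    have "(\<Prod>x\<leftarrow>zs. [:- x, 1:]) \<noteq> 0" by (auto simp: prod_list_zero_iff)
    then show ?case using Cons by (simp add: proots_mult del: mult_pCons_left)
  qed simp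
  from this[of xs] this[of ys] have "mset (rev xs) = mset (rev ys)" using eq by simp
  then have "rev xs = rev ys" using assms(2,3) by (metis properties_for_sort)
  then show ?thesis by simp
qed

lemma eigvals_desc_symmetric:
  assumes A: "A \<in> carrier_mat n n" and sym: "A\<^sup>T = A"
  shows "length (eigvals_desc A) = n" "sorted (rev (eigvals_desc A))"
    "char_poly A = (\<Prod>x\<leftarrow>eigvals_desc A. [:- x, 1:])"
proof -
  obtain es where es: "char_poly A = (\<Prod>e\<leftarrow>es. [:- e, 1:])" "length es = n"
    using symmetric_char_poly_splits[OF A sym] by blast
  define xs where "xs = rev (sort es)"
  have 1: "length xs = n" "sorted (rev xs)" using es unfolding xs_def by auto
  have "mset (map (\<lambda>e. [:- e, 1:]) xs) = mset (map (\<lambda>e. [:- e, 1:]) es)"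
    unfolding xs_def by simp
  then have "(\<Prod>e\<leftarrow>xs. [:- e, 1:]) = (\<Prod>e\<leftarrow>es. [:- e, 1:])"
    unfolding prod_mset_prod_list[symmetric] by simp
  then have *: "length xs = dim_row A \<and> sorted (rev xs) \<and> char_poly A = (\<Prod>x\<leftarrow>xs. [:- x, 1:])"
    using 1 es A by simp
  from * have "length (eigvals_desc A) = dim_row A \<and> sorted (rev (eigvals_desc A)) \<and>
    char_poly A = (\<Prod>x\<leftarrow>eigvals_desc A. [:- x, 1:])"
    unfolding eigvals_desc_def
  proof (rule theI)
    fix ys assume ys: "length ys = dim_row A \<and> sorted (rev ys) \<and> char_poly A = (\<Prod>x\<leftarrow>ys. [:- x, 1:])"
    show "ys = xs" using ys *
      by (intro linear_factors_unique) auto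
  qed
  then show "length (eigvals_desc A) = n" "sorted (rev (eigvals_desc A))"
    "char_poly A = (\<Prod>x\<leftarrow>eigvals_desc A. [:- x, 1:])" using A by auto
qed

lemma symmetric_spectral:
  assumes A: "A \<in> carrier_mat n n" and sym: "A\<^sup>T = A"
  obtains U where "U \<in> carrier_mat n n" "U\<^sup>T * U = 1\<^sub>m n" "U * U\<^sup>T = 1\<^sub>m n"
    "U\<^sup>T * A * U = mat_diag n (\<lambda>i. eigvals_desc A ! i)"
proof -
  obtain U where U: "U \<in> carrier_mat n n" and "U\<^sup>T * U = 1\<^sub>m n"
     "U\<^sup>T * A * U = mat_diag n (\<lambda>i. eigvals_desc A ! i)"
    using symmetric_diagonalization[OF A sym eigvals_desc_symmetric(3)[OF A sym]] by blast
  moreover have "U * U\<^sup>T = 1\<^sub>m n"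
    using mat_mult_left_right_inverse[of "U\<^sup>T" n U] U calculation by simp
  ultimately show ?thesis using that by blast
qed

lemma eigvals_desc_antimono:
  assumes "A \<in> carrier_mat n n" "A\<^sup>T = A" "i \<le> j" "j < n"
  shows "eigvals_desc A ! j \<le> eigvals_desc A ! i"
proof -
  note e = eigvals_desc_symmetric[OF assms(1,2)]
  have "rev (eigvals_desc A) ! (n - 1 - j) \<le> rev (eigvals_desc A) ! (n - 1 - i)"
    using e assms(3,4) by (intro sorted_nth_mono) auto
  then show ?thesis using e assms(3,4) by (simp add: rev_nth)
qed

section \<open>Positive semidefinite matrices and square roots\<close>

text \<open>Reassociation and transposition rules whose side conditions only mention dimensions, which
  the simplifier discharges more reliably than carrier memberships.\<close>

lemma mat_assoc:
  fixes A :: "'a :: semiring_0 mat"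
  assumes "dim_col A = dim_row B" "dim_col B = dim_row C"
  shows "A * B * C = A * (B * C)"
  by (rule assoc_mult_mat[of _ "dim_row A" "dim_col A" _ "dim_col B" _ "dim_col C"]) (use assms in auto)

lemma mat_transpose_mult:
  fixes A :: "'a :: comm_semiring_0 mat"
  assumes "dim_col A = dim_row B"
  shows "(A * B)\<^sup>T = B\<^sup>T * A\<^sup>T"
  by (rule transpose_mult[of _ "dim_row A" "dim_col A" _ "dim_col B"]) (use assms in auto)

text \<open>\<open>mat_assoc\<close> nests products to the right, so an inverse pair inside a long
  product appears in exactly this shape and can be cancelled by rewriting.\<close>

lemma mat_cancel_left:
  fixes A :: "'a :: semiring_1 mat"
  assumes "A * B = 1\<^sub>m n" "dim_col A = dim_row B" "dim_col B = dim_row C"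
  shows "A * (B * C) = C"
proof -
  have "dim_row C = n" using assms by (metis index_mult_mat(3) index_one_mat(3))
  then show ?thesis using mat_assoc[OF assms(2,3)] assms(1)
    by (metis carrier_matI left_mult_one_mat)
qed

lemma psd_mat_congruence:
  assumes K: "K \<in> carrier_mat n n" and psd: "psd_mat K" and B: "B \<in> carrier_mat n p"
  shows "psd_mat (B\<^sup>T * K * B)"
proof -
  have symK: "K\<^sup>T = K" using psd unfolding psd_mat_def sym_mat_def by simp
  have BT: "B\<^sup>T \<in> carrier_mat p n" using B by simp
  have "v \<bullet> (B\<^sup>T * K * B *\<^sub>v v) \<ge> 0" if v: "v \<in> carrier_vec p" for v
  proof -
    have Bv: "B *\<^sub>v v \<in> carrier_vec n" using B v by simp
    have "B\<^sup>T * K * B *\<^sub>v v = B\<^sup>T *\<^sub>v (K *\<^sub>v (B *\<^sub>v v))"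
      using assoc_mult_mat_vec[of "B\<^sup>T * K" p n B p v] assoc_mult_mat_vec[OF BT K Bv] BT K B v by simp
    then have "v \<bullet> (B\<^sup>T * K * B *\<^sub>v v) = (B\<^sup>T *\<^sub>v (K *\<^sub>v (B *\<^sub>v v))) \<bullet> v"
      using BT K Bv v by (simp add: comm_scalar_prod[of v p])
    also have "\<dots> = (K *\<^sub>v (B *\<^sub>v v)) \<bullet> (B *\<^sub>v v)"
      using B K Bv v by (intro transpose_vec_mult_scalar) auto
    also have "\<dots> = (B *\<^sub>v v) \<bullet> (K *\<^sub>v (B *\<^sub>v v))"
      using K Bv by (intro comm_scalar_prod[of _ n]) auto
    finally show ?thesis using psd K Bv unfolding psd_mat_def by simp
  qed
  moreover have "(B\<^sup>T * K * B)\<^sup>T = B\<^sup>T * K * B"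
    using B K by (simp add: mat_transpose_mult symK mat_assoc del: assoc_mult_mat)
  ultimately show ?thesis using B unfolding psd_mat_def sym_mat_def by simp
qed

lemma psd_mat_one: "psd_mat (1\<^sub>m n)"
proof -
  have "v \<bullet> v \<ge> 0" for v :: "real vec" by (auto simp: scalar_prod_def intro: sum_nonneg)
  then show ?thesis unfolding psd_mat_def sym_mat_def by simp
qed

lemma psd_mat_gram:
  assumes "B \<in> carrier_mat n p"
  shows "psd_mat (B\<^sup>T * B)"
  using psd_mat_congruence[of "1\<^sub>m n" n B p] psd_mat_one assms by simp

lemma psd_mat_diag_nonneg:
  assumes A: "A \<in> carrier_mat n n" and psd: "psd_mat A" and i: "i < n"
  shows "A $$ (i,i) \<ge> 0"
proof -
  have "unit_vec n i \<bullet> (A *\<^sub>v unit_vec n i) \<ge> 0" using psd A unfolding psd_mat_def by simp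
  moreover have "unit_vec n i \<bullet> (A *\<^sub>v unit_vec n i) = A $$ (i,i)"
    using A i by (subst scalar_prod_left_unit[of _ n]) auto
  ultimately show ?thesis by simp
qed

lemma eigvals_desc_psd_nonneg:
  assumes A: "A \<in> carrier_mat n n" and psd: "psd_mat A" and i: "i < n"
  shows "eigvals_desc A ! i \<ge> 0"
proof -
  have sym: "A\<^sup>T = A" using psd unfolding psd_mat_def sym_mat_def by simp
  obtain U where U: "U \<in> carrier_mat n n"
    "U\<^sup>T * A * U = mat_diag n (\<lambda>i. eigvals_desc A ! i)"
    using symmetric_spectral[OF A sym] by metis
  have "(U\<^sup>T * A * U) $$ (i,i) \<ge> 0"
    using psd_mat_diag_nonneg[OF _ psd_mat_congruence[OF A psd U(1)] i] U(1) A by simp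
  then show ?thesis using U(2) i by (simp add: mat_diag_def)
qed

lemma symmetric_spectral_expand:
  fixes A :: "real mat"
  assumes A: "A \<in> carrier_mat n n" and U: "U \<in> carrier_mat n n" and UU: "U * U\<^sup>T = 1\<^sub>m n"
    and D: "U\<^sup>T * A * U = D"
  shows "A = U * D * U\<^sup>T"
proof -
  have "U * D * U\<^sup>T = U * (U\<^sup>T * (A * (U * U\<^sup>T)))"
    unfolding D[symmetric] using A U by (simp add: mat_assoc del: assoc_mult_mat)
  also have "\<dots> = A" using A U by (simp add: UU mat_cancel_left[OF UU])
  finally show ?thesis by simp
qed

lemma psd_sqrt_exists:
  assumes A: "A \<in> carrier_mat n n" and psd: "psd_mat A"
  shows "\<exists>S \<in> carrier_mat n n. psd_mat S \<and> S * S = A"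
proof -
  have sym: "A\<^sup>T = A" using psd unfolding psd_mat_def sym_mat_def by simp
  define e where "e i = eigvals_desc A ! i" for i
  obtain U where U: "U \<in> carrier_mat n n" "U\<^sup>T * U = 1\<^sub>m n" "U * U\<^sup>T = 1\<^sub>m n"
    "U\<^sup>T * A * U = mat_diag n e"
    using symmetric_spectral[OF A sym] unfolding e_def by metis
  have e: "e i \<ge> 0" if "i < n" for i
    using eigvals_desc_psd_nonneg[OF A psd that] unfolding e_def .
  \<comment> \<open>Fourth roots of the eigenvalues: with \<open>D * D\<close> in the middle,
    \<open>S\<close> is the Gram matrix of \<open>D * U\<^sup>T\<close> and therefore psd at
    once.\<close>
  define D where "D = mat_diag n (\<lambda>i. sqrt (sqrt (e i)))"
  have D: "D \<in> carrier_mat n n" "D\<^sup>T = D" unfolding D_def mat_diag_def by auto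
  have DD: "D * D * (D * D) = mat_diag n e"
  proof -
    have "sqrt (sqrt x) * sqrt (sqrt x) * (sqrt (sqrt x) * sqrt (sqrt x)) = x" if "x \<ge> 0" for x :: real
      using that by simp
    then show ?thesis unfolding D_def mat_diag_diag
      by (intro eq_matI) (auto simp: mat_diag_def e)
  qed
  define S where "S = U * (D * D) * U\<^sup>T"
  have S: "S \<in> carrier_mat n n" unfolding S_def
    by (intro mult_carrier_mat[of _ n n]) (use U D in auto)
  have "S = (D * U\<^sup>T)\<^sup>T * (D * U\<^sup>T)"
    unfolding S_def using U D by (simp add: mat_assoc mat_transpose_mult del: assoc_mult_mat)
  then have 1: "psd_mat S" using psd_mat_gram[of "D * U\<^sup>T" n n] U D by simp
  have "S * S = U * (D * D * (D * D)) * U\<^sup>T"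
    unfolding S_def using U D by (simp add: mat_assoc mat_cancel_left[OF U(2)] del: assoc_mult_mat)
  also have "\<dots> = A" unfolding DD
    using symmetric_spectral_expand[OF A U(1,3,4)] by simp
  finally show ?thesis using S 1 by blast
qed

lemma psd_sqrt_unique:
  assumes S: "S \<in> carrier_mat n n" "psd_mat S" and T: "T \<in> carrier_mat n n" "psd_mat T"
    and eq: "S * S = T * T"
  shows "S = T"
proof -
  have sym: "S\<^sup>T = S" "T\<^sup>T = T" using S T unfolding psd_mat_def sym_mat_def by auto
  \<comment> \<open>\<open>D S + T D = S S - T T = 0\<close>; in an eigenbasis of \<open>D\<close> the diagonal entries of this identity force
    every eigenvalue of \<open>D\<close> to vanish.\<close>
  define D where "D = S - T"
  have D: "D \<in> carrier_mat n n" unfolding D_def using T(1) by (rule minus_carrier_mat)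
  have symD: "D\<^sup>T = D" unfolding D_def using S T sym by (simp add: transpose_minus)
  define d where "d i = eigvals_desc D ! i" for i
  obtain U where U: "U \<in> carrier_mat n n" "U\<^sup>T * U = 1\<^sub>m n" "U * U\<^sup>T = 1\<^sub>m n"
    "U\<^sup>T * D * U = mat_diag n d"
    using symmetric_spectral[OF D symD] unfolding d_def by metis
  have UT: "U\<^sup>T \<in> carrier_mat n n" using U by simp
  define S' T' where "S' = U\<^sup>T * S * U" and "T' = U\<^sup>T * T * U"
  have S': "S' \<in> carrier_mat n n" and T': "T' \<in> carrier_mat n n"
    unfolding S'_def T'_def using U S T by auto
  have eq': "S' * S' = T' * T'"
  proof -
    have "S' * S' = U\<^sup>T * ((S * S) * U)" "T' * T' = U\<^sup>T * ((T * T) * U)"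
      unfolding S'_def T'_def using U S T
      by (simp_all add: mat_assoc mat_cancel_left[OF U(3)] del: assoc_mult_mat)
    then show ?thesis using eq by simp
  qed
  have D': "mat_diag n d = S' - T'"
    unfolding U(4)[symmetric] S'_def T'_def D_def using U S T
    by (simp add: mult_minus_distrib_mat[OF UT S(1) T(1)] minus_mult_distrib_mat[of _ n n _ _ n])
  have comm: "mat_diag n d * S' + T' * mat_diag n d = 0\<^sub>m n n"
  proof -
    have "mat_diag n d * S' + T' * mat_diag n d = (S' * S' - T' * S') + (T' * S' - T' * T')"
      unfolding D' using S' T'
      by (simp add: mult_minus_distrib_mat[OF T' S' T'] minus_mult_distrib_mat[OF S' T' S'])
    also have "\<dots> = 0\<^sub>m n n" unfolding eq' using S' T' by (intro eq_matI) auto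
    finally show ?thesis .
  qed
  have "d i = 0" if i: "i < n" for i
  proof -
    have "d i * S' $$ (i,i) + T' $$ (i,i) * d i = 0"
      using arg_cong[OF comm, of "\<lambda>M. M $$ (i,i)"] i S' T'
      by (simp add: mat_diag_mult_left[OF S'] mat_diag_mult_right[OF T'])
    moreover have "d i = S' $$ (i,i) - T' $$ (i,i)"
      using arg_cong[OF D', of "\<lambda>M. M $$ (i,i)"] i S' T' by (simp add: mat_diag_def)
    moreover have "S' $$ (i,i) \<ge> 0" "T' $$ (i,i) \<ge> 0"
      using psd_mat_diag_nonneg[OF S' _ i] psd_mat_diag_nonneg[OF T' _ i]
        psd_mat_congruence[OF S U(1)] psd_mat_congruence[OF T U(1)] unfolding S'_def T'_def by auto
    \<comment> \<open>With diagonal entries s and t, the first identity reads (s - t)(s + t) = 0. As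
      s and t are nonnegative, s = t.\<close>
    ultimately show ?thesis
      by (smt (verit) mult.commute mult_eq_0_iff mult_less_0_iff distrib_left)
  qed
  then have "mat_diag n d = 0\<^sub>m n n" by (intro eq_matI) (auto simp: mat_diag_def)
  then have "D = 0\<^sub>m n n"
    using symmetric_spectral_expand[OF D U(1,3,4)] U by simp
  then have "(S - T) $$ (i,j) = 0\<^sub>m n n $$ (i,j)" for i j unfolding D_def by simp
  then have "S $$ (i,j) = T $$ (i,j)" if "i < n" "j < n" for i j
    using that S T by (metis carrier_matD eq_iff_diff_eq_0 index_minus_mat(1) index_zero_mat(1))
  then show ?thesis using S T by (intro eq_matI) auto
qed

lemma psd_sqrt_psd:
  assumes A: "A \<in> carrier_mat n n" and psd: "psd_mat A"
  shows "psd_sqrt A \<in> carrier_mat n n" "psd_mat (psd_sqrt A)" "psd_sqrt A * psd_sqrt A = A"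
proof -
  obtain S where S: "S \<in> carrier_mat n n" "psd_mat S" "S * S = A"
    using psd_sqrt_exists[OF A psd] by blast
  have "psd_sqrt A = S" unfolding psd_sqrt_def
  proof (rule the_equality)
    fix T assume "T \<in> carrier_mat (dim_row A) (dim_row A) \<and> psd_mat T \<and> T * T = A"
    then show "T = S" using psd_sqrt_unique[of T n S] S A by simp
  qed (use S A in simp)
  then show "psd_sqrt A \<in> carrier_mat n n" "psd_mat (psd_sqrt A)" "psd_sqrt A * psd_sqrt A = A"
    using S by auto
qed

section \<open>Inverses and inverse square roots\<close>

lemma inv_mat_eqI:
  assumes K: "K \<in> carrier_mat n n" and C: "C \<in> carrier_mat n n" and "K * C = 1\<^sub>m n" "C * K = 1\<^sub>m n"
  shows "inv_mat K = C"
  unfolding inv_mat_def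
proof (rule the_equality)
  fix B assume "B \<in> carrier_mat (dim_row K) (dim_row K) \<and> inverts_mat K B \<and> inverts_mat B K"
  then have B: "B \<in> carrier_mat n n" "B * K = 1\<^sub>m n" using K unfolding inverts_mat_def by auto
  have "B = B * (K * C)" using B assms(3) by simp
  also have "\<dots> = C" using B K C by (intro mat_cancel_left[OF B(2)]) auto
  finally show "B = C" .
qed (use assms in \<open>auto simp: inverts_mat_def\<close>)

lemma inv_sqrt_psd:
  assumes K: "K \<in> carrier_mat n n" and psd: "psd_mat K" and det: "det K \<noteq> 0"
  shows "inv_sqrt K \<in> carrier_mat n n" "(inv_sqrt K)\<^sup>T = inv_sqrt K"
    "inv_sqrt K * K * inv_sqrt K = 1\<^sub>m n" "inv_sqrt K * inv_sqrt K * K = 1\<^sub>m n"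
proof -
  have symK: "K\<^sup>T = K" using psd unfolding psd_mat_def sym_mat_def by simp
  obtain C where C: "C \<in> carrier_mat n n" "C * K = 1\<^sub>m n" "K * C = 1\<^sub>m n"
    using det_non_zero_imp_unit[OF K det, of "()"]
    unfolding Units_def ring_mat_def by auto
  have CT: "C\<^sup>T \<in> carrier_mat n n" using C by simp
  have "C\<^sup>T * K = (K\<^sup>T * C)\<^sup>T" using K C by (simp add: mat_transpose_mult)
  then have CTK: "C\<^sup>T * K = 1\<^sub>m n" using symK C by simp
  \<comment> \<open>The inverse is a congruence transform of \<open>K\<close>, hence psd.\<close>
  then have "C\<^sup>T * K * C = C" using C by simp
  then have psdC: "psd_mat C" using psd_mat_congruence[OF K psd C(1)] by simp
  have inv: "inv_mat K = C" by (rule inv_mat_eqI[OF K C(1,3,2)])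
  define R where "R = inv_sqrt K"
  have R: "R \<in> carrier_mat n n" "psd_mat R" "R * R = C"
    using psd_sqrt_psd[OF C(1) psdC] unfolding R_def inv_sqrt_def inv by auto
  have RRK: "R * (R * K) = 1\<^sub>m n" using R C K by (simp add: mat_assoc[symmetric] del: assoc_mult_mat)
  \<comment> \<open>A right inverse of a square matrix is also a left inverse, which moves one
    \<open>R\<close> to the other side without showing separately that \<open>R\<close> and
    \<open>K\<close> commute.\<close>
  have "R * K * R = 1\<^sub>m n"
    using mat_mult_left_right_inverse[OF R(1) _ RRK] R K by simp
  then show "inv_sqrt K \<in> carrier_mat n n" "(inv_sqrt K)\<^sup>T = inv_sqrt K"
    "inv_sqrt K * K * inv_sqrt K = 1\<^sub>m n" "inv_sqrt K * inv_sqrt K * K = 1\<^sub>m n"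
    using R C unfolding R_def psd_mat_def sym_mat_def by auto
qed

section \<open>Rearrangement and trace inequalities\<close>

text \<open>Here \<open>s\<close> is the orthogonal projection of \<open>x\<close> onto the span of
  the \<open>y j\<close>. Its squared norm and its inner product with \<open>x\<close> both equal
  \<open>B\<close>, so the squared distance is \<open>|x|^2 - B\<close>. The family is not
  normalised; a zero weight has coefficient 0 because division by zero is 0.\<close>

lemma bessel_inequality_orthogonal:
  fixes y :: "nat \<Rightarrow> nat \<Rightarrow> real"
  assumes orth: "\<And>i j. i < q \<Longrightarrow> j < q \<Longrightarrow> (\<Sum>l<m. y i l * y j l) = (if i = j then w i else 0)"
  shows "(\<Sum>j<q. (\<Sum>l<m. x l * y j l)\<^sup>2 / w j) \<le> (\<Sum>l<m. (x l)\<^sup>2)"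
proof -
  define c where "c j = (\<Sum>l<m. x l * y j l) / w j" for j
  define s where "s l = (\<Sum>j<q. c j * y j l)" for l
  define B where "B = (\<Sum>j<q. (\<Sum>l<m. x l * y j l)\<^sup>2 / w j)"
  have xs: "(\<Sum>l<m. x l * s l) = B"
  proof -
    have "(\<Sum>l<m. x l * s l) = (\<Sum>l<m. \<Sum>j<q. c j * (x l * y j l))"
      unfolding s_def by (simp add: sum_distrib_left mult_ac)
    also have "\<dots> = (\<Sum>j<q. c j * (\<Sum>l<m. x l * y j l))"
      by (subst sum.swap) (simp add: sum_distrib_left)
    finally show ?thesis unfolding B_def c_def by (simp add: power2_eq_square)
  qed
  have ss: "(\<Sum>l<m. (s l)\<^sup>2) = B"
  proof -
    have "(\<Sum>l<m. (s l)\<^sup>2) = (\<Sum>l<m. \<Sum>i<q. \<Sum>j<q. c i * c j * (y i l * y j l))"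
      unfolding s_def power2_eq_square sum_product by (simp add: mult_ac)
    also have "\<dots> = (\<Sum>i<q. \<Sum>l<m. \<Sum>j<q. c i * c j * (y i l * y j l))"
      by (rule sum.swap)
    also have "\<dots> = (\<Sum>i<q. \<Sum>j<q. c i * c j * (\<Sum>l<m. y i l * y j l))"
      by (rule sum.cong[OF refl], subst sum.swap) (simp add: sum_distrib_left)
    also have "\<dots> = (\<Sum>i<q. \<Sum>j<q. if j = i then c i * c i * w i else 0)"
      by (intro sum.cong refl) (use orth in auto)
    also have "\<dots> = (\<Sum>i<q. c i * c i * w i)" by (simp add: sum.delta)
    also have "\<dots> = B" unfolding B_def c_def by (intro sum.cong refl) (simp add: power2_eq_square)
    finally show ?thesis .
  qed
  have "0 \<le> (\<Sum>l<m. (x l - s l)\<^sup>2)" by (intro sum_nonneg) auto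
  also have "\<dots> = (\<Sum>l<m. (x l)\<^sup>2) - 2 * (\<Sum>l<m. x l * s l) + (\<Sum>l<m. (s l)\<^sup>2)"
    by (simp add: power2_diff sum.distrib sum_subtractf sum_distrib_left mult_ac)
  finally show ?thesis using xs ss unfolding B_def by simp
qed

text \<open>A dimension count by double summation: otherwise \<open>m + 1\<close> orthogonal vectors
  with positive weights would live in \<open>m\<close> coordinates, and summing Bessel's inequality
  over all unit vectors would give \<open>m + 1\<close> at most \<open>m\<close>.\<close>

lemma orthogonal_family_weight_vanishes:
  fixes y :: "nat \<Rightarrow> nat \<Rightarrow> real"
  assumes orth: "\<And>i j. i < q \<Longrightarrow> j < q \<Longrightarrow> (\<Sum>l<m. y i l * y j l) = (if i = j then w i else 0)"
    and mono: "\<And>i j. i \<le> j \<Longrightarrow> j < q \<Longrightarrow> w j \<le> w i"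
    and nonneg: "\<And>i. i < q \<Longrightarrow> 0 \<le> w i"
    and j: "m \<le> j" "j < q"
  shows "w j = 0"
proof (rule ccontr)
  assume "w j \<noteq> 0"
  then have pos: "w i > 0" if "i < Suc m" for i using mono[of i j] nonneg[of j] j that by force
  \<comment> \<open>Each summand over \<open>l\<close> is Bessel's inequality for the
    \<open>l\<close>-th unit vector.\<close>
  have "(\<Sum>l<m. \<Sum>i<Suc m. (y i l)\<^sup>2 / w i) \<le> (\<Sum>l<m. 1)"
  proof (rule sum_mono)
    fix l assume l: "l \<in> {..<m}"
    have "(\<Sum>i<Suc m. (\<Sum>l'<m. (if l' = l then 1 else 0) * y i l')\<^sup>2 / w i)
      \<le> (\<Sum>l'<m. (if l' = l then 1 else 0)\<^sup>2)"
      by (rule bessel_inequality_orthogonal) (use orth j in auto)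
    also have "(\<Sum>l'<m. (if l' = l then 1 else 0 :: real)\<^sup>2) = (\<Sum>l'<m. if l' = l then 1 else 0)"
      by (intro sum.cong) auto
    finally show "(\<Sum>i<Suc m. (y i l)\<^sup>2 / w i) \<le> 1"
      using l by (simp add: if_distrib[of "\<lambda>x. x * _"] sum.delta cong: if_cong)
  qed
  also have "(\<Sum>l<m. \<Sum>i<Suc m. (y i l)\<^sup>2 / w i) = (\<Sum>i<Suc m. (\<Sum>l<m. y i l * y i l) / w i)"
    by (subst sum.swap) (simp add: sum_divide_distrib power2_eq_square)
  also have "\<dots> = (\<Sum>i<Suc m. 1)"
  proof (rule sum.cong[OF refl])
    fix i assume "i \<in> {..<Suc m}"
    then show "(\<Sum>l<m. y i l * y i l) / w i = 1" using orth[of i i] pos[of i] j by auto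
  qed
  finally show False by simp
qed

section \<open>Rearrangement for doubly substochastic weights\<close>

lemma sum_differences_eq:
  fixes a :: "nat \<Rightarrow> real"
  assumes "a n = 0" "i < n"
  shows "a i = (\<Sum>p<n. (a p - a (Suc p)) * (if i \<le> p then 1 else 0))"
proof -
  have "(\<Sum>p<n. (a p - a (Suc p)) * (if i \<le> p then 1 else 0)) = (\<Sum>p\<in>{i..<n}. a p - a (Suc p))"
    by (intro sum.mono_neutral_cong_right) auto
  also have "\<dots> = a i - a n" using assms(2) by (simp add: sum_Suc_diff'[of i n "\<lambda>p. - a p", simplified])
  finally show ?thesis using assms(1) by simp
qed

text \<open>Both weights are written as nonnegative combinations of indicators of initial segments; for
  indicators, the claim is that the sum of \<open>S\<close> over an \<open>a \<times> b\<close> rectangle is at most \<open>min a b\<close>.\<close>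

lemma substochastic_rearrangement:
  fixes a b :: "nat \<Rightarrow> real" and S :: "nat \<Rightarrow> nat \<Rightarrow> real"
  assumes a: "antimono a" "a n = 0" and b: "antimono b" "b n = 0"
    and S: "\<And>i j. 0 \<le> S i j"
    and row: "\<And>i. i < n \<Longrightarrow> (\<Sum>j<n. S i j) \<le> 1"
    and col: "\<And>j. j < n \<Longrightarrow> (\<Sum>i<n. S i j) \<le> 1"
  shows "(\<Sum>i<n. \<Sum>j<n. a i * b j * S i j) \<le> (\<Sum>i<n. a i * b i)"
proof -
  define I where "I i p = (if i \<le> p then 1 else 0 :: real)" for i p :: nat
  define \<alpha> where "\<alpha> p = a p - a (Suc p)" for p
  define \<beta> where "\<beta> p = b p - b (Suc p)" for p
  have \<alpha>0: "0 \<le> \<alpha> p" and \<beta>0: "0 \<le> \<beta> p" for p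
    using a(1) b(1) unfolding \<alpha>_def \<beta>_def antimono_def by auto
  have ai: "a i = (\<Sum>p<n. \<alpha> p * I i p)" and bi: "b i = (\<Sum>p<n. \<beta> p * I i p)" if "i < n" for i
    using sum_differences_eq[where a = a, OF a(2) that] sum_differences_eq[where a = b, OF b(2) that]
    unfolding \<alpha>_def \<beta>_def I_def by auto
  \<comment> \<open>The kernel \<open>T\<close> is arbitrary because the expansion is applied to
    \<open>S\<close> and to the identity kernel, reducing the comparison to rectangles.\<close>
  have layer: "(\<Sum>i<n. \<Sum>j<n. a i * b j * T i j)
      = (\<Sum>p<n. \<Sum>q<n. \<alpha> p * \<beta> q * (\<Sum>i<n. \<Sum>j<n. I i p * I j q * T i j))" for T
  proof -
    have "(\<Sum>i<n. \<Sum>j<n. a i * b j * T i j)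
      = (\<Sum>i<n. \<Sum>j<n. \<Sum>p<n. \<Sum>q<n. \<alpha> p * \<beta> q * (I i p * I j q * T i j))"
    proof (intro sum.cong refl)
      fix i j assume ij: "i \<in> {..<n}" "j \<in> {..<n}"
      have *: "a i * b j * T i j = (\<Sum>p<n. \<Sum>q<n. \<alpha> p * I i p * (\<beta> q * I j q)) * T i j"
        using ij by (simp only: ai bi sum_product lessThan_iff)
      show "a i * b j * T i j = (\<Sum>p<n. \<Sum>q<n. \<alpha> p * \<beta> q * (I i p * I j q * T i j))"
        unfolding * sum_distrib_right by (intro sum.cong refl) (simp add: mult_ac)
    qed
    also have "\<dots> = (\<Sum>i<n. \<Sum>p<n. \<Sum>j<n. \<Sum>q<n. \<alpha> p * \<beta> q * (I i p * I j q * T i j))"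
      by (intro sum.cong refl sum.swap)
    also have "\<dots> = (\<Sum>p<n. \<Sum>i<n. \<Sum>j<n. \<Sum>q<n. \<alpha> p * \<beta> q * (I i p * I j q * T i j))"
      by (rule sum.swap)
    also have "\<dots> = (\<Sum>p<n. \<Sum>i<n. \<Sum>q<n. \<Sum>j<n. \<alpha> p * \<beta> q * (I i p * I j q * T i j))"
      by (intro sum.cong refl sum.swap)
    also have "\<dots> = (\<Sum>p<n. \<Sum>q<n. \<Sum>i<n. \<Sum>j<n. \<alpha> p * \<beta> q * (I i p * I j q * T i j))"
      by (intro sum.cong refl sum.swap)
    finally show ?thesis by (simp add: sum_distrib_left)
  qed
  have rect: "(\<Sum>i<n. \<Sum>j<n. I i p * I j q * S i j)
      \<le> (\<Sum>i<n. \<Sum>j<n. I i p * I j q * (if i = j then 1 else 0))" if "p < n" "q < n" for p q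
  proof -
    have rhs: "(\<Sum>i<n. \<Sum>j<n. I i p * I j q * (if i = j then 1 else 0)) = (\<Sum>i<n. I i p * I i q)"
      by (intro sum.cong refl) (simp add: if_distrib[of "\<lambda>x. _ * x"] sum.delta cong: if_cong)
    have le1: "(\<Sum>i<n. \<Sum>j<n. I i p * I j q * S i j) \<le> (\<Sum>i<n. I i p)"
    proof (rule sum_mono)
      fix i assume "i \<in> {..<n}"
      have "(\<Sum>j<n. I i p * I j q * S i j) \<le> I i p * (\<Sum>j<n. S i j)"
        unfolding sum_distrib_left by (intro sum_mono) (auto simp: I_def S)
      also have "\<dots> \<le> I i p * 1" using row \<open>i \<in> {..<n}\<close> by (intro mult_left_mono) (auto simp: I_def)
      finally show "(\<Sum>j<n. I i p * I j q * S i j) \<le> I i p" by simp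
    qed
    have le2: "(\<Sum>i<n. \<Sum>j<n. I i p * I j q * S i j) \<le> (\<Sum>j<n. I j q)"
      unfolding sum.swap[of "\<lambda>i j. I i p * I j q * S i j"]
    proof (rule sum_mono)
      fix j assume "j \<in> {..<n}"
      have "(\<Sum>i<n. I i p * I j q * S i j) \<le> I j q * (\<Sum>i<n. S i j)"
        unfolding sum_distrib_left by (intro sum_mono) (auto simp: I_def S)
      also have "\<dots> \<le> I j q * 1" using col \<open>j \<in> {..<n}\<close> by (intro mult_left_mono) (auto simp: I_def)
      finally show "(\<Sum>i<n. I i p * I j q * S i j) \<le> I j q" by simp
    qed
    \<comment> \<open>The shorter side decides: row sums bound the rectangle when
      \<open>p \<le> q\<close>, column sums otherwise.\<close>
    show ?thesis
    proof (cases "p \<le> q")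
      case True
      then have "(\<Sum>i<n. I i p * I i q) = (\<Sum>i<n. I i p)" by (intro sum.cong refl) (auto simp: I_def)
      then show ?thesis using le1 rhs by linarith
    next
      case False
      then have "(\<Sum>i<n. I i p * I i q) = (\<Sum>i<n. I i q)" by (intro sum.cong refl) (auto simp: I_def)
      then show ?thesis using le2 rhs by linarith
    qed
  qed
  have "(\<Sum>i<n. \<Sum>j<n. a i * b j * S i j)
    \<le> (\<Sum>i<n. \<Sum>j<n. a i * b j * (if i = j then 1 else 0))"
    unfolding layer by (intro sum_mono mult_left_mono rect) (auto simp: \<alpha>0 \<beta>0)
  also have "\<dots> = (\<Sum>i<n. a i * b i)"
    by (intro sum.cong refl) (simp add: if_distrib[of "\<lambda>x. _ * x"] sum.delta cong: if_cong)
  finally show ?thesis .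
qed

text \<open>Serves as the Frobenius inner product: \<open>mat_tr (X\<^sup>T * Y)\<close> pairs
  \<open>X\<close> with \<open>Y\<close>, and Gram matrices give squared norms.\<close>

definition mat_tr :: "real mat \<Rightarrow> real" where
  "mat_tr A = (\<Sum>i<dim_row A. A $$ (i,i))"

lemma mat_tr_mult:
  assumes "A \<in> carrier_mat n p" "B \<in> carrier_mat p n"
  shows "mat_tr (A * B) = (\<Sum>i<n. \<Sum>j<p. A $$ (i,j) * B $$ (j,i))"
  unfolding mat_tr_def using assms
  by (auto simp: scalar_prod_def lessThan_atLeast0 intro!: sum.cong)

lemma mat_tr_comm:
  assumes "A \<in> carrier_mat n p" "B \<in> carrier_mat p n"
  shows "mat_tr (A * B) = mat_tr (B * A)"
  unfolding mat_tr_mult[OF assms] mat_tr_mult[OF assms(2,1)]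
  by (subst sum.swap) (simp add: mult.commute)

lemma mat_tr_transpose_mult:
  assumes "A \<in> carrier_mat n p" "B \<in> carrier_mat n p"
  shows "mat_tr (A\<^sup>T * B) = (\<Sum>i<p. \<Sum>j<n. A $$ (j,i) * B $$ (j,i))"
  using assms by (subst mat_tr_mult[of _ p n]) auto

lemma mat_tr_gram_diff:
  assumes A: "A \<in> carrier_mat n p" and B: "B \<in> carrier_mat n p"
  shows "mat_tr ((A - B)\<^sup>T * (A - B)) = mat_tr (A\<^sup>T * A) - 2 * mat_tr (A\<^sup>T * B) + mat_tr (B\<^sup>T * B)"
proof -
  have "A - B \<in> carrier_mat n p" using B by (rule minus_carrier_mat)
  then have "mat_tr ((A - B)\<^sup>T * (A - B)) = (\<Sum>i<p. \<Sum>j<n. (A $$ (j,i) - B $$ (j,i)) * (A $$ (j,i) - B $$ (j,i)))"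
    using A B by (simp add: mat_tr_transpose_mult)
  also have "\<dots> = (\<Sum>i<p. \<Sum>j<n. A $$ (j,i) * A $$ (j,i) - 2 * (A $$ (j,i) * B $$ (j,i)) + B $$ (j,i) * B $$ (j,i))"
    by (intro sum.cong refl) (simp add: algebra_simps)
  finally show ?thesis using A B
    by (simp add: mat_tr_transpose_mult sum.distrib sum_subtractf sum_distrib_left)
qed

lemma mat_tr_gram_nonneg: "mat_tr (A\<^sup>T * A) \<ge> 0"
  by (subst mat_tr_transpose_mult[of _ "dim_row A" "dim_col A"]) (auto intro!: sum_nonneg)

lemma mat_tr_gram_eq_0:
  assumes A: "A \<in> carrier_mat n p" and "mat_tr (A\<^sup>T * A) = 0"
  shows "A = 0\<^sub>m n p"
proof (rule eq_matI)
  fix i j assume "i < dim_row (0\<^sub>m n p :: real mat)" "j < dim_col (0\<^sub>m n p :: real mat)"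
  then have ij: "i < n" "j < p" by auto
  have "(\<Sum>i<p. \<Sum>j<n. A $$ (j,i) * A $$ (j,i)) = 0"
    using assms by (simp add: mat_tr_transpose_mult[OF A A])
  then have "(\<Sum>l<n. A $$ (l,j) * A $$ (l,j)) = 0"
    using ij by (subst (asm) sum_nonneg_eq_0_iff) (auto intro!: sum_nonneg)
  then have "A $$ (i,j) * A $$ (i,j) = 0"
    using ij by (subst (asm) sum_nonneg_eq_0_iff) auto
  then show "A $$ (i,j) = 0\<^sub>m n p $$ (i,j)" using ij by simp
qed (use A in auto)

text \<open>The right half of a singular value decomposition: \<open>Z\<close> is an eigenbasis of
  the Gram matrix. Zero columns may remain, since no left singular vectors are formed.\<close>

lemma gram_orthogonal_columns:
  fixes A :: "real mat"
  assumes A: "A \<in> carrier_mat m p"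
  obtains Z where "Z \<in> carrier_mat p p" "Z * Z\<^sup>T = 1\<^sub>m p"
    "\<And>i j. i < p \<Longrightarrow> j < p \<Longrightarrow> (\<Sum>l<m. (A * Z) $$ (l,i) * (A * Z) $$ (l,j)) =
       (if i = j then eigvals_desc (A\<^sup>T * A) ! i else 0)"
proof -
  have G: "A\<^sup>T * A \<in> carrier_mat p p" using A by simp
  have symG: "(A\<^sup>T * A)\<^sup>T = A\<^sup>T * A" using A by (simp add: mat_transpose_mult)
  obtain Z where Z: "Z \<in> carrier_mat p p" "Z * Z\<^sup>T = 1\<^sub>m p"
     "Z\<^sup>T * (A\<^sup>T * A) * Z = mat_diag p (\<lambda>i. eigvals_desc (A\<^sup>T * A) ! i)"
    using symmetric_spectral[OF G symG] by metis
  have AZ: "A * Z \<in> carrier_mat m p" using A Z by simp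
  have eq: "(A * Z)\<^sup>T * (A * Z) = mat_diag p (\<lambda>i. eigvals_desc (A\<^sup>T * A) ! i)"
    unfolding Z(3)[symmetric] using A Z(1) by (simp add: mat_transpose_mult mat_assoc del: assoc_mult_mat)
  have "(\<Sum>l<m. (A * Z) $$ (l,i) * (A * Z) $$ (l,j)) = (if i = j then eigvals_desc (A\<^sup>T * A) ! i else 0)"
    if ij: "i < p" "j < p" for i j
  proof -
    have "(X\<^sup>T * X) $$ (i,j) = (\<Sum>l<m. X $$ (l,i) * X $$ (l,j))" if "X \<in> carrier_mat m p" for X :: "real mat"
      using ij that by (simp add: scalar_prod_def lessThan_atLeast0)
    from this[OF AZ]
    show ?thesis unfolding eq using ij by (cases "i = j") (simp_all add: mat_diag_def)
  qed
  then show ?thesis using that Z by blast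
qed

text \<open>Row and column sums of the normalised squared inner products are controlled by Bessel's
  inequality; division by a zero weight yields \<open>0\<close>, which is harmless since the corresponding
  vector vanishes.\<close>

lemma orthogonal_families_inner_products:
  fixes x y :: "nat \<Rightarrow> nat \<Rightarrow> real"
  assumes x: "\<And>i j. i < p \<Longrightarrow> j < p \<Longrightarrow> (\<Sum>l<m. x i l * x j l) = (if i = j then v i else 0)"
    and y: "\<And>i j. i < q \<Longrightarrow> j < q \<Longrightarrow> (\<Sum>l<m. y i l * y j l) = (if i = j then w i else 0)"
    and v: "\<And>i j. i \<le> j \<Longrightarrow> j < p \<Longrightarrow> v j \<le> v i" "\<And>i. i < p \<Longrightarrow> 0 \<le> v i"
    and w: "\<And>i j. i \<le> j \<Longrightarrow> j < q \<Longrightarrow> w j \<le> w i" "\<And>i. i < q \<Longrightarrow> 0 \<le> w i"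
  shows "(\<Sum>i<p. \<Sum>j<q. (\<Sum>l<m. x i l * y j l)\<^sup>2)
    \<le> (\<Sum>i<m. (if i < p then v i else 0) * (if i < q then w i else 0))"
proof -
  define h where "h i j = (\<Sum>l<m. x i l * y j l)" for i j
  define a where "a i = (if i < p then v i else 0)" for i
  define b where "b i = (if i < q then w i else 0)" for i
  \<comment> \<open>A common index range: both padded weights vanish at \<open>n\<close>, as the
    rearrangement requires, and it contains \<open>{..<m}\<close> for the final truncation.\<close>
  define n where "n = m + p + q"
  define S where "S i j = (if i < p \<and> j < q then (h i j)\<^sup>2 / (a i * b j) else 0)" for i j
  have a: "antimono a" "a n = 0" "\<And>i. a i \<ge> 0" and b: "antimono b" "b n = 0" "\<And>i. b i \<ge> 0"
    using v w unfolding a_def b_def n_def antimono_def by auto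
  have S0: "0 \<le> S i j" for i j unfolding S_def using a b by simp
  have nx: "(\<Sum>l<m. (x i l)\<^sup>2) = a i" if "i < p" for i
    using x[OF that that] that unfolding a_def by (simp add: power2_eq_square)
  have ny: "(\<Sum>l<m. (y i l)\<^sup>2) = b i" if "i < q" for i
    using y[OF that that] that unfolding b_def by (simp add: power2_eq_square)
  have row: "(\<Sum>j<n. S i j) \<le> 1" for i
  proof (cases "i < p")
    case True
    have "(\<Sum>j<n. S i j) = (\<Sum>j<q. (h i j)\<^sup>2 / b j / a i)"
      using True by (intro sum.mono_neutral_cong_right) (auto simp: S_def n_def)
    also have "\<dots> = (\<Sum>j<q. (h i j)\<^sup>2 / b j) / a i" by (simp add: sum_divide_distrib)
    also have "\<dots> \<le> a i / a i"
    proof (rule divide_right_mono[OF _ a(3)])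
      have "(\<Sum>j<q. (h i j)\<^sup>2 / b j) \<le> (\<Sum>l<m. (x i l)\<^sup>2)"
        unfolding h_def by (rule bessel_inequality_orthogonal) (use y in \<open>auto simp: b_def\<close>)
      then show "(\<Sum>j<q. (h i j)\<^sup>2 / b j) \<le> a i" using nx[OF True] by simp
    qed
    finally show ?thesis by (cases "a i = 0") auto
  qed (simp add: S_def)
  have col: "(\<Sum>i<n. S i j) \<le> 1" for j
  proof (cases "j < q")
    case True
    have "(\<Sum>i<n. S i j) = (\<Sum>i<p. (h i j)\<^sup>2 / a i / b j)"
      using True by (intro sum.mono_neutral_cong_right) (auto simp: S_def n_def)
    also have "\<dots> = (\<Sum>i<p. (h i j)\<^sup>2 / a i) / b j" by (simp add: sum_divide_distrib)
    also have "\<dots> \<le> b j / b j"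
    proof (rule divide_right_mono[OF _ b(3)])
      have "(\<Sum>i<p. (\<Sum>l<m. y j l * x i l)\<^sup>2 / a i) \<le> (\<Sum>l<m. (y j l)\<^sup>2)"
        by (rule bessel_inequality_orthogonal) (use x in \<open>auto simp: a_def\<close>)
      then show "(\<Sum>i<p. (h i j)\<^sup>2 / a i) \<le> b j"
        using ny[OF True] unfolding h_def by (simp add: mult.commute)
    qed
    finally show ?thesis by (cases "b j = 0") auto
  qed (simp add: S_def)
  have h0: "(h i j)\<^sup>2 = a i * b j * S i j" if "i < p" "j < q" for i j
  proof (cases "a i = 0 \<or> b j = 0")
    case True
    then have "(\<forall>l<m. x i l = 0) \<or> (\<forall>l<m. y j l = 0)"
      using nx[OF that(1)] ny[OF that(2)] by (auto simp: sum_nonneg_eq_0_iff)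
    then show ?thesis using True unfolding h_def by auto
  qed (use that in \<open>simp add: S_def\<close>)
  have "(\<Sum>i<p. \<Sum>j<q. (h i j)\<^sup>2) = (\<Sum>i<p. \<Sum>j<q. a i * b j * S i j)"
    by (intro sum.cong refl) (simp add: h0)
  also have "\<dots> = (\<Sum>i<p. \<Sum>j<n. a i * b j * S i j)"
    by (intro sum.cong[OF refl] sum.mono_neutral_left) (auto simp: S_def n_def)
  also have "\<dots> = (\<Sum>i<n. \<Sum>j<n. a i * b j * S i j)"
    by (rule sum.mono_neutral_left) (auto simp: S_def n_def)
  also have "\<dots> \<le> (\<Sum>i<n. a i * b i)"
    by (rule substochastic_rearrangement[OF a(1,2) b(1,2) S0 row col])
  also have "\<dots> = (\<Sum>i<m. a i * b i)"
  proof (rule sum.mono_neutral_right)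
    have "a i = 0" if "m \<le> i" for i
      using orthogonal_family_weight_vanishes[OF x v that] unfolding a_def by auto
    then show "\<forall>i\<in>{..<n} - {..<m}. a i * b i = 0" by auto
  qed (auto simp: n_def)
  finally show ?thesis unfolding h_def a_def b_def .
qed

section \<open>Trace bound in terms of singular values\<close>

lemma sing_val_power2:
  assumes A: "A \<in> carrier_mat m m'"
  shows "(sing_val A i)\<^sup>2 = (if i < min m m' then eigvals_desc (A\<^sup>T * A) ! i else 0)"
  using A eigvals_desc_psd_nonneg[OF _ psd_mat_gram[OF A], of m' i]
  by (auto simp: sing_val_def)

text \<open>Since \<open>C\<close> has only \<open>m\<close> rows, its first \<open>m\<close> Gram
  eigenvalues carry the whole trace of \<open>C\<^sup>T * C\<close>. Subtracting the bound on the
  trace of \<open>A\<^sup>T * C\<close> therefore leaves exactly the weights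
  \<open>1 - (sing_val A i)\<^sup>2\<close>.\<close>

lemma sing_val_trace_bound:
  assumes A: "A \<in> carrier_mat m m'" and C: "C \<in> carrier_mat m k" and mk: "m \<le> k"
  shows "(\<Sum>i<m. (1 - (sing_val A i)\<^sup>2) * eigvals_desc (C\<^sup>T * C) ! i)
    \<le> mat_tr (C\<^sup>T * C) - mat_tr ((A\<^sup>T * C)\<^sup>T * (A\<^sup>T * C))"
proof -
  define v where "v i = eigvals_desc (A\<^sup>T * A) ! i" for i
  define w where "w i = eigvals_desc (C\<^sup>T * C) ! i" for i
  have AA: "A\<^sup>T * A \<in> carrier_mat m' m'" "(A\<^sup>T * A)\<^sup>T = A\<^sup>T * A"
    and CC: "C\<^sup>T * C \<in> carrier_mat k k" "(C\<^sup>T * C)\<^sup>T = C\<^sup>T * C"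
    using A C by (auto simp: mat_transpose_mult)
  have v: "\<And>i j. i \<le> j \<Longrightarrow> j < m' \<Longrightarrow> v j \<le> v i" "\<And>i. i < m' \<Longrightarrow> 0 \<le> v i"
    unfolding v_def
    by (auto intro: eigvals_desc_antimono[OF AA] eigvals_desc_psd_nonneg[OF AA(1) psd_mat_gram[OF A]])
  have w: "\<And>i j. i \<le> j \<Longrightarrow> j < k \<Longrightarrow> w j \<le> w i" "\<And>i. i < k \<Longrightarrow> 0 \<le> w i"
    unfolding w_def
    by (auto intro: eigvals_desc_antimono[OF CC] eigvals_desc_psd_nonneg[OF CC(1) psd_mat_gram[OF C]])
  obtain Z where Z: "Z \<in> carrier_mat m' m'" "Z * Z\<^sup>T = 1\<^sub>m m'"
    and x: "\<And>i j. i < m' \<Longrightarrow> j < m' \<Longrightarrow> (\<Sum>l<m. (A * Z) $$ (l,i) * (A * Z) $$ (l,j)) = (if i = j then v i else 0)"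
    using gram_orthogonal_columns[OF A, folded v_def] by blast
  obtain V where V: "V \<in> carrier_mat k k" "V * V\<^sup>T = 1\<^sub>m k"
    and y: "\<And>i j. i < k \<Longrightarrow> j < k \<Longrightarrow> (\<Sum>l<m. (C * V) $$ (l,i) * (C * V) $$ (l,j)) = (if i = j then w i else 0)"
    using gram_orthogonal_columns[OF C, folded w_def] by blast
  have AZ: "A * Z \<in> carrier_mat m m'" and CV: "C * V \<in> carrier_mat m k" using A C Z V by auto
  define H where "H = (A * Z)\<^sup>T * (C * V)"
  have H: "H \<in> carrier_mat m' k" unfolding H_def using AZ CV by auto
  have VT: "V\<^sup>T \<in> carrier_mat k k" using V by simp
  have "mat_tr (H\<^sup>T * H) = mat_tr ((V\<^sup>T * ((A\<^sup>T * C)\<^sup>T * (A\<^sup>T * C))) * V)"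
    unfolding H_def using A C Z(1) V(1)
    by (simp add: mat_transpose_mult mat_assoc mat_cancel_left[OF Z(2)] del: assoc_mult_mat)
  also have "\<dots> = mat_tr (V * (V\<^sup>T * ((A\<^sup>T * C)\<^sup>T * (A\<^sup>T * C))))"
    by (rule mat_tr_comm[of _ k k]) (use A C V in auto)
  also have "V * (V\<^sup>T * ((A\<^sup>T * C)\<^sup>T * (A\<^sup>T * C))) = (A\<^sup>T * C)\<^sup>T * (A\<^sup>T * C)"
    by (rule mat_cancel_left[OF V(2)]) (use A C V in auto)
  finally have trH: "mat_tr ((A\<^sup>T * C)\<^sup>T * (A\<^sup>T * C)) = mat_tr (H\<^sup>T * H)" by simp
  also have "\<dots> = (\<Sum>i<m'. \<Sum>j<k. (H $$ (i,j))\<^sup>2)"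
    by (subst mat_tr_transpose_mult[OF H H], subst sum.swap) (simp add: power2_eq_square)
  also have "\<dots> = (\<Sum>i<m'. \<Sum>j<k. (\<Sum>l<m. (A * Z) $$ (l,i) * (C * V) $$ (l,j))\<^sup>2)"
  proof (intro sum.cong refl)
    fix i j assume "i \<in> {..<m'}" "j \<in> {..<k}"
    then have ij: "i < m'" "j < k" by auto
    have "(X\<^sup>T * Y) $$ (i,j) = (\<Sum>l<m. X $$ (l,i) * Y $$ (l,j))"
      if "X \<in> carrier_mat m m'" "Y \<in> carrier_mat m k" for X Y :: "real mat"
      using ij that by (simp add: scalar_prod_def lessThan_atLeast0)
    from this[OF AZ CV] show "(H $$ (i,j))\<^sup>2 = (\<Sum>l<m. (A * Z) $$ (l,i) * (C * V) $$ (l,j))\<^sup>2"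
      unfolding H_def by (rule arg_cong)
  qed
  also have "\<dots> \<le> (\<Sum>i<m. (if i < m' then v i else 0) * (if i < k then w i else 0))"
    by (rule orthogonal_families_inner_products[OF x y v w])
  \<comment> \<open>For \<open>i < m\<close> the test \<open>i < m'\<close> coincides with the one
    in \<open>sing_val\<close>, so the zero paddings agree.\<close>
  also have "\<dots> = (\<Sum>i<m. (sing_val A i)\<^sup>2 * w i)"
    by (intro sum.cong refl) (use mk in \<open>auto simp: sing_val_power2[OF A] v_def\<close>)
  finally have 1: "mat_tr ((A\<^sup>T * C)\<^sup>T * (A\<^sup>T * C)) \<le> (\<Sum>i<m. (sing_val A i)\<^sup>2 * w i)" .
  have "mat_tr (C\<^sup>T * C) = mat_tr ((V * V\<^sup>T) * (C\<^sup>T * C))"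
    by (simp only: V(2) left_mult_one_mat[OF CC(1)])
  also have "\<dots> = mat_tr (V * (V\<^sup>T * (C\<^sup>T * C)))"
    using V(1) C by (simp add: mat_assoc del: assoc_mult_mat)
  also have "\<dots> = mat_tr ((V\<^sup>T * (C\<^sup>T * C)) * V)"
    by (rule mat_tr_comm[of _ k k]) (use C V in auto)
  also have "\<dots> = mat_tr ((C * V)\<^sup>T * (C * V))"
    using V(1) C by (simp add: mat_transpose_mult mat_assoc del: assoc_mult_mat)
  also have "\<dots> = (\<Sum>i<k. w i)" unfolding mat_tr_transpose_mult[OF CV CV]
    by (rule sum.cong[OF refl], subst y) auto
  also have "\<dots> = (\<Sum>i<m. w i)"
    using orthogonal_family_weight_vanishes[OF y w] mk by (intro sum.mono_neutral_right) auto
  finally have 2: "mat_tr (C\<^sup>T * C) = (\<Sum>i<m. w i)" .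
  show ?thesis using 1 unfolding 2 w_def[symmetric] by (simp add: left_diff_distrib sum_subtractf)
qed

section \<open>Second moments\<close>

lemma integrable_mult_of_squares:
  fixes a b :: "'a \<Rightarrow> real"
  assumes "a \<in> borel_measurable M" "b \<in> borel_measurable M"
    and "integrable M (\<lambda>x. (a x)\<^sup>2)" "integrable M (\<lambda>x. (b x)\<^sup>2)"
  shows "integrable M (\<lambda>x. a x * b x)"
proof (rule Bochner_Integration.integrable_bound)
  show "integrable M (\<lambda>x. (a x)\<^sup>2 + (b x)\<^sup>2)" using assms by simp
  have bound: "\<bar>s * t\<bar> \<le> s\<^sup>2 + t\<^sup>2" for s t :: real
  proof -
    have "2 * \<bar>s * t\<bar> \<le> s\<^sup>2 + t\<^sup>2"
      using sum_squares_bound[of "\<bar>s\<bar>" "\<bar>t\<bar>"] by (simp add: abs_mult mult.assoc)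
    then show ?thesis using abs_ge_zero[of "s * t"] by linarith
  qed
  show "AE x in M. norm (a x * b x) \<le> norm ((a x)\<^sup>2 + (b x)\<^sup>2)"
  proof (rule AE_I2)
    fix x show "norm (a x * b x) \<le> norm ((a x)\<^sup>2 + (b x)\<^sup>2)"
      using bound[of "a x" "b x"] unfolding real_norm_def by linarith
  qed
qed (intro borel_measurable_times assms)

lemma is_model_integrable_mult:
  fixes f f' :: "'a \<Rightarrow> real vec"
  assumes "is_model M m k f L" "is_model M m' k' f' L'" "i < m" "j < m'"
  shows "integrable M (\<lambda>x. f x $ i * f' x $ j)"
  using assms by (intro integrable_mult_of_squares) (auto simp: is_model_def)

lemma mult_mat_vec_index_sum:
  fixes B :: "real mat"
  assumes "B \<in> carrier_mat p m" "v \<in> carrier_vec m" "i < p"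
  shows "(B *\<^sub>v v) $ i = (\<Sum>l<m. B $$ (i,l) * v $ l)"
  using assms by (simp add: scalar_prod_def lessThan_atLeast0)

lemma integral_linear_images_mult:
  fixes f f' :: "'a \<Rightarrow> real vec"
  assumes mf: "is_model M m k f L" and mf': "is_model M m' k' f' L'"
    and B: "B \<in> carrier_mat p m" and B': "B' \<in> carrier_mat q m'" and i: "i < p" and j: "j < q"
  shows "integrable M (\<lambda>x. (B *\<^sub>v f x) $ i * (B' *\<^sub>v f' x) $ j)"
    and "integral\<^sup>L M (\<lambda>x. (B *\<^sub>v f x) $ i * (B' *\<^sub>v f' x) $ j)
      = (B * moment_mat M m m' f f' * B'\<^sup>T) $$ (i,j)"
proof -
  note int = is_model_integrable_mult[OF mf mf']
  have fx: "f x \<in> carrier_vec m" "f' x \<in> carrier_vec m'" if "x \<in> space M" for x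
    using mf mf' that unfolding is_model_def by auto
  have eq: "(B *\<^sub>v f x) $ i * (B' *\<^sub>v f' x) $ j
    = (\<Sum>a<m. \<Sum>b<m'. B $$ (i,a) * B' $$ (j,b) * (f x $ a * f' x $ b))" if "x \<in> space M" for x
    unfolding mult_mat_vec_index_sum[OF B fx(1)[OF that] i] mult_mat_vec_index_sum[OF B' fx(2)[OF that] j]
    by (simp add: sum_product mult_ac)
  have "integrable M (\<lambda>x. \<Sum>a<m. \<Sum>b<m'. B $$ (i,a) * B' $$ (j,b) * (f x $ a * f' x $ b))"
    using int by (intro Bochner_Integration.integrable_sum integrable_mult_right) auto
  then show "integrable M (\<lambda>x. (B *\<^sub>v f x) $ i * (B' *\<^sub>v f' x) $ j)"
    by (subst Bochner_Integration.integrable_cong[OF refl eq])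
  define G where "G = moment_mat M m m' f f'"
  have G: "G \<in> carrier_mat m m'" unfolding G_def moment_mat_def by simp
  have "integral\<^sup>L M (\<lambda>x. (B *\<^sub>v f x) $ i * (B' *\<^sub>v f' x) $ j)
    = integral\<^sup>L M (\<lambda>x. \<Sum>a<m. \<Sum>b<m'. B $$ (i,a) * B' $$ (j,b) * (f x $ a * f' x $ b))"
    by (rule Bochner_Integration.integral_cong[OF refl eq])
  also have "\<dots> = (\<Sum>a<m. \<Sum>b<m'. B $$ (i,a) * B' $$ (j,b) * integral\<^sup>L M (\<lambda>x. f x $ a * f' x $ b))"
  proof -
    have "integral\<^sup>L M (\<lambda>x. \<Sum>b<m'. B $$ (i,a) * B' $$ (j,b) * (f x $ a * f' x $ b))
      = (\<Sum>b<m'. B $$ (i,a) * B' $$ (j,b) * integral\<^sup>L M (\<lambda>x. f x $ a * f' x $ b))" if "a < m" for a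
      using int that by (subst Bochner_Integration.integral_sum) auto
    then show ?thesis
      using int by (subst Bochner_Integration.integral_sum) (auto intro!: Bochner_Integration.integrable_sum)
  qed
  also have "\<dots> = (\<Sum>a<m. \<Sum>b<m'. B $$ (i,a) * G $$ (a,b) * B' $$ (j,b))"
    by (intro sum.cong refl) (simp add: G_def moment_mat_def)
  also have "\<dots> = (\<Sum>b<m'. (\<Sum>a<m. B $$ (i,a) * G $$ (a,b)) * B' $$ (j,b))"
    by (subst sum.swap) (simp add: sum_distrib_right)
  also have "\<dots> = (B * G * B'\<^sup>T) $$ (i,j)"
    using B B' G i j by (simp add: scalar_prod_def lessThan_atLeast0 del: assoc_mult_mat)
  finally show "integral\<^sup>L M (\<lambda>x. (B *\<^sub>v f x) $ i * (B' *\<^sub>v f' x) $ j)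
    = (B * moment_mat M m m' f f' * B'\<^sup>T) $$ (i,j)" unfolding G_def .
qed

lemma moment_mat_carrier [simp]: "moment_mat M m m' f f' \<in> carrier_mat m m'"
  unfolding moment_mat_def by simp

lemma moment_mat_linear_images:
  fixes f f' :: "'a \<Rightarrow> real vec"
  assumes "is_model M m k f L" "is_model M m' k' f' L'" "B \<in> carrier_mat p m" "B' \<in> carrier_mat q m'"
  shows "moment_mat M p q (\<lambda>x. B *\<^sub>v f x) (\<lambda>x. B' *\<^sub>v f' x) = B * moment_mat M m m' f f' * B'\<^sup>T"
proof (rule eq_matI)
  fix i j assume "i < dim_row (B * moment_mat M m m' f f' * B'\<^sup>T)" "j < dim_col (B * moment_mat M m m' f f' * B'\<^sup>T)"
  then have "i < p" "j < q" using assms by auto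
  then show "moment_mat M p q (\<lambda>x. B *\<^sub>v f x) (\<lambda>x. B' *\<^sub>v f' x) $$ (i,j) = (B * moment_mat M m m' f f' * B'\<^sup>T) $$ (i,j)"
    using integral_linear_images_mult(2)[OF assms, of i j] by (simp add: moment_mat_def)
qed (use assms in \<open>auto simp: moment_mat_def\<close>)

text \<open>General coefficient matrices let one formula cover both the full error, with
  \<open>L\<^sup>T\<close> and \<open>L'\<^sup>T\<close>, and the error after projection to the row
  space of \<open>L'\<close>.\<close>

lemma integral_dist_linear_images:
  fixes f f' :: "'a \<Rightarrow> real vec"
  assumes mf: "is_model M m k f L" and mf': "is_model M m' k' f' L'"
    and B: "B \<in> carrier_mat p m" and B': "B' \<in> carrier_mat p m'"
  shows "integral\<^sup>L M (\<lambda>x. \<Sum>j<p. ((B *\<^sub>v f x) $ j - (B' *\<^sub>v f' x) $ j)\<^sup>2)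
    = mat_tr (B * moment_mat M m m f f * B\<^sup>T) - 2 * mat_tr (B * moment_mat M m m' f f' * B'\<^sup>T)
      + mat_tr (B' * moment_mat M m' m' f' f' * B'\<^sup>T)"
proof -
  note 1 = integral_linear_images_mult[OF mf mf B B]
  note 2 = integral_linear_images_mult[OF mf mf' B B']
  note 3 = integral_linear_images_mult[OF mf' mf' B' B']
  have "integral\<^sup>L M (\<lambda>x. \<Sum>j<p. ((B *\<^sub>v f x) $ j - (B' *\<^sub>v f' x) $ j)\<^sup>2)
    = integral\<^sup>L M (\<lambda>x. \<Sum>j<p. (B *\<^sub>v f x) $ j * (B *\<^sub>v f x) $ j
        - 2 * ((B *\<^sub>v f x) $ j * (B' *\<^sub>v f' x) $ j) + (B' *\<^sub>v f' x) $ j * (B' *\<^sub>v f' x) $ j)"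
    by (intro Bochner_Integration.integral_cong refl sum.cong) (simp add: power2_eq_square algebra_simps)
  also have "\<dots> = (\<Sum>j<p. (B * moment_mat M m m f f * B\<^sup>T) $$ (j,j)
      - 2 * (B * moment_mat M m m' f f' * B'\<^sup>T) $$ (j,j) + (B' * moment_mat M m' m' f' f' * B'\<^sup>T) $$ (j,j))"
  proof (subst Bochner_Integration.integral_sum)
    fix j assume "j \<in> {..<p}"
    then have j: "j < p" by simp
    show "integrable M (\<lambda>x. (B *\<^sub>v f x) $ j * (B *\<^sub>v f x) $ j
        - 2 * ((B *\<^sub>v f x) $ j * (B' *\<^sub>v f' x) $ j) + (B' *\<^sub>v f' x) $ j * (B' *\<^sub>v f' x) $ j)"
      using 1(1)[OF j j] 2(1)[OF j j] 3(1)[OF j j]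
      by (intro Bochner_Integration.integrable_add Bochner_Integration.integrable_diff integrable_mult_right)
  qed (intro sum.cong refl, simp add: 1 2 3 del: index_mult_mat index_mult_mat_vec)
  finally show ?thesis using B B' by (simp add: mat_tr_def sum.distrib sum_subtractf sum_distrib_left del: index_mult_mat(1))
qed

lemma moment_mat_psd:
  fixes f :: "'a \<Rightarrow> real vec"
  assumes mf: "is_model M m k f L"
  shows "psd_mat (moment_mat M m m f f)"
proof -
  define F where "F = moment_mat M m m f f"
  have F: "F \<in> carrier_mat m m" unfolding F_def by simp
  have "v \<bullet> (F *\<^sub>v v) \<ge> 0" if v: "v \<in> carrier_vec m" for v
  proof -
    \<comment> \<open>With \<open>v\<close> as a single row, the quadratic form at \<open>v\<close>
      becomes the second moment of a scalar function.\<close>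
    define B where "B = mat 1 m (\<lambda>(i,j). v $ j)"
    have B: "B \<in> carrier_mat 1 m" unfolding B_def by simp
    have "integral\<^sup>L M (\<lambda>x. (B *\<^sub>v f x) $ 0 * (B *\<^sub>v f x) $ 0) \<ge> 0" by (intro integral_nonneg_AE) auto
    then have "0 \<le> (B * F * B\<^sup>T) $$ (0,0)"
      using integral_linear_images_mult(2)[OF mf mf B B, of 0 0] unfolding F_def by simp
    also have "(B * F * B\<^sup>T) $$ (0,0) = row B 0 \<bullet> col (F * B\<^sup>T) 0"
      using B F by simp
    also have "row B 0 = v" using v unfolding B_def by (intro eq_vecI) auto
    also have "col (F * B\<^sup>T) 0 = F *\<^sub>v v"
      using B F \<open>row B 0 = v\<close> by (subst col_mult2[of _ m m _ 1]) auto
    finally show ?thesis .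
  qed
  moreover have "F\<^sup>T = F" unfolding F_def moment_mat_def by (intro eq_matI) (auto simp: mult.commute)
  ultimately show ?thesis using F unfolding F_def[symmetric] psd_mat_def sym_mat_def by auto
qed

text \<open>A kernel vector \<open>v\<close> of \<open>L * L\<^sup>T\<close> has
  \<open>L\<^sup>T *\<^sub>v v\<close> of norm zero, so it is orthogonal to every column of
  \<open>L\<close>; but \<open>m\<close> of these columns are independent.\<close>

lemma full_row_rank_det_gram:
  fixes L :: "real mat"
  assumes L: "L \<in> carrier_mat m k" and rank: "vec_space.rank m L = m"
  shows "det (L * L\<^sup>T) \<noteq> 0"
proof
  assume "det (L * L\<^sup>T) = 0"
  then obtain v where v: "v \<in> carrier_vec m" "v \<noteq> 0\<^sub>v m" "L * L\<^sup>T *\<^sub>v v = 0\<^sub>v m"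
    using det_0_iff_vec_prod_zero[of "L * L\<^sup>T" m] L by auto
  have LT: "L\<^sup>T \<in> carrier_mat k m" using L by simp
  define w where "w = L\<^sup>T *\<^sub>v v"
  have w: "w \<in> carrier_vec k" unfolding w_def using LT v by simp
  have "w \<bullet> w = v \<bullet> (L *\<^sub>v w)"
    unfolding w_def using L v by (intro transpose_vec_mult_scalar[OF L]) auto
  also have "L *\<^sub>v w = L * L\<^sup>T *\<^sub>v v" unfolding w_def using L LT v by simp
  finally have "w \<bullet> w = 0" using v by simp
  then have w0: "w $ j = 0" if "j < k" for j
    using w that by (simp add: scalar_prod_def sum_nonneg_eq_0_iff)
  interpret vec_space "TYPE(real)" m .
  \<comment> \<open>The rank is the size of a maximal independent set of columns; its members become
    the columns of an invertible square matrix \<open>B\<close>.\<close>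
  obtain S where S: "maximal S (\<lambda>T. T \<subseteq> set (cols L) \<and> lin_indpt T)"
    using maximal_exists[of "(\<lambda>T. T \<subseteq> set (cols L) \<and> lin_indpt T)" "card (set (cols L))" "{}"]
    by (meson List.finite_set card_mono empty_iff empty_subsetI finite_lin_indpt2 rev_finite_subset)
  have "card S = m" using rank_card_indpt[OF L S] rank by simp
  have Sc: "S \<subseteq> set (cols L)" "lin_indpt S" using S unfolding maximal_def by auto
  obtain ws where ws: "set ws = S" "distinct ws"
    using finite_distinct_list[of S] Sc(1) finite_subset by blast
  have len: "length ws = m" using ws \<open>card S = m\<close> distinct_card by fastforce
  have wsc: "set ws \<subseteq> carrier_vec m" using ws Sc cols_dim[of L] L by auto
  define B where "B = mat_of_cols m ws"
  have B: "B \<in> carrier_mat m m" unfolding B_def using len by auto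
  have "cols B = ws" unfolding B_def using wsc by (rule cols_mat_of_cols)
  then have "rank B = m" using lin_indpt_full_rank[OF B] ws Sc by simp
  then have "det (B\<^sup>T) \<noteq> 0" using det_rank_iff[OF B] det_transpose[OF B] by simp
  moreover have "B\<^sup>T *\<^sub>v v = 0\<^sub>v m"
  proof (rule eq_vecI)
    fix i assume "i < dim_vec (0\<^sub>v m :: real vec)"
    then have i: "i < m" by simp
    then have "ws ! i \<in> set (cols L)" using ws Sc len nth_mem by blast
    then obtain j where j: "j < k" "ws ! i = col L j" using L by (auto simp: cols_def)
    have "(B\<^sup>T *\<^sub>v v) $ i = col L j \<bullet> v"
      using B i len wsc j nth_mem[of i ws] by (simp add: B_def subset_iff)
    also have "\<dots> = w $ j" unfolding w_def using L j by simp
    finally show "(B\<^sup>T *\<^sub>v v) $ i = 0\<^sub>v m $ i" using w0[OF j(1)] i by simp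
  qed (use B in simp)
  ultimately show False
    using det_0_iff_vec_prod_zero[of "B\<^sup>T" m] B v by auto
qed

section \<open>The two similarity bounds\<close>

text \<open>\<open>P\<^sup>T * P\<close> is the orthogonal projection onto the row space of
  \<open>L\<close>; the last two claims say, from either side, that it fixes the rows of
  \<open>L\<close>.\<close>

lemma row_space_projection:
  fixes L :: "real mat"
  assumes L: "L \<in> carrier_mat m k" and rank: "vec_space.rank m L = m"
  defines "P \<equiv> inv_sqrt (L * L\<^sup>T) * L"
  shows "P \<in> carrier_mat m k" "P\<^sup>T = L\<^sup>T * inv_sqrt (L * L\<^sup>T)" "P\<^sup>T * (P * L\<^sup>T) = L\<^sup>T"
    "L * (P\<^sup>T * P) = L"
proof -
  define R where "R = inv_sqrt (L * L\<^sup>T)"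
  have K: "L * L\<^sup>T \<in> carrier_mat m m" using L by simp
  have "psd_mat (L * L\<^sup>T)" using psd_mat_gram[of "L\<^sup>T" k m] L by simp
  note R = inv_sqrt_psd[OF K this full_row_rank_det_gram[OF L rank], folded R_def]
  have P: "P = R * L" unfolding P_def R_def ..
  show Pc: "P \<in> carrier_mat m k" unfolding P using R(1) L by simp
  show PT: "P\<^sup>T = L\<^sup>T * inv_sqrt (L * L\<^sup>T)"
    unfolding P R_def[symmetric] using R(1,2) L by (simp add: mat_transpose_mult)
  have "P\<^sup>T * (P * L\<^sup>T) = L\<^sup>T * (R * R * (L * L\<^sup>T))"
    unfolding P using R(1,2) L by (simp add: mat_transpose_mult mat_assoc del: assoc_mult_mat)
  also have "\<dots> = L\<^sup>T" unfolding R(4) using L by simp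
  finally show 1: "P\<^sup>T * (P * L\<^sup>T) = L\<^sup>T" .
  have "L * (P\<^sup>T * P) = (P\<^sup>T * (P * L\<^sup>T))\<^sup>T"
    using Pc L by (simp add: mat_transpose_mult mat_assoc del: assoc_mult_mat)
  then show "L * (P\<^sup>T * P) = L" unfolding 1 by simp
qed

lemma unembedding_similarity_bound:
  fixes f f' :: "'a \<Rightarrow> real vec"
  assumes model: "is_model M m k f L" and model': "is_model M m' k f' L'"
    and rank: "vec_space.rank m L = m" and rank': "vec_space.rank m' L' = m'"
  shows "(\<Sum>i<m. (1 - (sing_val (inv_sqrt (L * L\<^sup>T) * L * L'\<^sup>T * inv_sqrt (L' * L'\<^sup>T)) i)\<^sup>2)
        * eigvals_desc (L\<^sup>T * moment_mat M m m f f * L) ! i)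
    \<le> integral\<^sup>L M (\<lambda>x. \<Sum>j<k. ((L\<^sup>T *\<^sub>v f x) $ j - (L'\<^sup>T *\<^sub>v f' x) $ j)\<^sup>2)"
proof -
  define F G F' where "F = moment_mat M m m f f" and "G = moment_mat M m m' f f'"
    and "F' = moment_mat M m' m' f' f'"
  have F: "F \<in> carrier_mat m m" and G: "G \<in> carrier_mat m m'" and F': "F' \<in> carrier_mat m' m'"
    unfolding F_def G_def F'_def by auto
  have L: "L \<in> carrier_mat m k" and L': "L' \<in> carrier_mat m' k"
    using model model' unfolding is_model_def by auto
  have mk: "m \<le> k" using vec_space.rank_le_nc[OF L] rank by simp
  define P where "P = inv_sqrt (L * L\<^sup>T) * L"
  note P = row_space_projection[OF L rank, folded P_def]
  define P' where "P' = inv_sqrt (L' * L'\<^sup>T) * L'"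
  note P' = row_space_projection[OF L' rank', folded P'_def]
  define U where "U = L\<^sup>T * F * L"
  have U: "U \<in> carrier_mat k k" unfolding U_def using L F by auto
  have psdU: "psd_mat U" unfolding U_def F_def
    by (rule psd_mat_congruence[OF _ moment_mat_psd[OF model] L]) simp
  define N where "N = psd_sqrt U"
  note N = psd_sqrt_psd[OF U psdU, folded N_def]
  have symN: "N\<^sup>T = N" using N(2) unfolding psd_mat_def sym_mat_def by simp
  have PU: "P\<^sup>T * (P * U) = U"
  proof -
    have "P\<^sup>T * (P * U) = P\<^sup>T * (P * L\<^sup>T) * (F * L)"
      unfolding U_def using L F P(1) by (simp add: mat_assoc del: assoc_mult_mat)
    then show ?thesis unfolding P(3) U_def using L F by (simp add: mat_assoc del: assoc_mult_mat)
  qed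
  have UP: "U * (P\<^sup>T * P) = U"
  proof -
    have "U * (P\<^sup>T * P) = L\<^sup>T * F * (L * (P\<^sup>T * P))"
      unfolding U_def using L F P(1) by (simp add: mat_assoc del: assoc_mult_mat)
    then show ?thesis unfolding P(4) U_def .
  qed
  \<comment> \<open>The goal is that the projection also fixes the root \<open>N\<close> of
    \<open>U\<close>, not only \<open>U\<close>. Since \<open>X\<^sup>T * X\<close> and
    \<open>X\<^sup>T * N\<close> both equal \<open>U\<close>, the Frobenius distance from
    \<open>X\<close> to \<open>N\<close> is zero; no comparison of kernels is needed.\<close>
  define X where "X = N * (P\<^sup>T * P)"
  have X: "X \<in> carrier_mat k k" unfolding X_def using N(1) P(1) by auto
  have XT: "X\<^sup>T = P\<^sup>T * (P * N)"
    unfolding X_def using N(1) P(1) symN by (simp add: mat_transpose_mult mat_assoc del: assoc_mult_mat)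
  have XTN: "X\<^sup>T * N = U"
  proof -
    have "X\<^sup>T * N = P\<^sup>T * (P * (N * N))"
      unfolding XT using N(1) P(1) by (simp add: mat_assoc del: assoc_mult_mat)
    then show ?thesis unfolding N(3) PU .
  qed
  have "X\<^sup>T * X = (X\<^sup>T * N) * (P\<^sup>T * P)"
    using X N(1) P(1) by (subst X_def) (simp add: mat_assoc del: assoc_mult_mat)
  then have XTX: "X\<^sup>T * X = U" unfolding XTN UP .
  have "mat_tr ((X - N)\<^sup>T * (X - N)) = 0"
    unfolding mat_tr_gram_diff[OF X N(1)] XTX XTN symN N(3) by simp
  then have diff0: "X - N = 0\<^sub>m k k"
    by (rule mat_tr_gram_eq_0[OF minus_carrier_mat[OF N(1)]])
  have XN: "X = N"
  proof (rule eq_matI)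
    fix i j assume "i < dim_row N" "j < dim_col N"
    then have "(X - N) $$ (i,j) = X $$ (i,j) - N $$ (i,j)" and "i < k" "j < k" using N(1) by auto
    then show "X $$ (i,j) = N $$ (i,j)" unfolding diff0 by simp
  qed (use X N(1) in auto)
  define C where "C = P * N"
  have C: "C \<in> carrier_mat m k" unfolding C_def using P(1) N(1) by simp
  have PTC: "P\<^sup>T * C = N" unfolding C_def using XT XN symN by simp
  have CC: "C\<^sup>T * C = U"
  proof -
    have "C\<^sup>T * C = N * (P\<^sup>T * C)"
      by (subst (1) C_def) (use P(1) N(1) symN C in \<open>simp add: mat_transpose_mult mat_assoc del: assoc_mult_mat\<close>)
    then show ?thesis unfolding PTC N(3) .
  qed
  define A where "A = P * P'\<^sup>T"
  have A: "A \<in> carrier_mat m m'" unfolding A_def using P(1) P'(1) by auto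
  have Rc: "dim_row (inv_sqrt (L' * L'\<^sup>T)) = dim_col L'\<^sup>T"
    using arg_cong[OF P'(2), of dim_col] arg_cong[OF P'_def, of dim_row] P'(1) L' by simp
  have A_eq: "inv_sqrt (L * L\<^sup>T) * L * L'\<^sup>T * inv_sqrt (L' * L'\<^sup>T) = A"
    unfolding A_def P'(2) P_def[symmetric] using P(1) L' Rc by (simp add: mat_assoc del: assoc_mult_mat)
  have AC: "A\<^sup>T * C = P' * N"
  proof -
    have "A\<^sup>T * C = P' * (P\<^sup>T * C)"
      unfolding A_def using P(1) P'(1) C by (simp add: mat_transpose_mult mat_assoc del: assoc_mult_mat)
    then show ?thesis unfolding PTC .
  qed
  have "mat_tr ((P' * N)\<^sup>T * (P' * N)) = mat_tr ((P' * N) * (P' * N)\<^sup>T)"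
    by (rule mat_tr_comm[of _ k m']) (use P'(1) N(1) in auto)
  also have "(P' * N) * (P' * N)\<^sup>T = P' * (N * N) * P'\<^sup>T"
    using P'(1) N(1) symN by (simp add: mat_transpose_mult mat_assoc del: assoc_mult_mat)
  finally have trAC: "mat_tr ((A\<^sup>T * C)\<^sup>T * (A\<^sup>T * C)) = mat_tr (P' * U * P'\<^sup>T)"
    unfolding AC N(3) .
  \<comment> \<open>By cyclicity the projection acts on \<open>L'\<close>, which it fixes: pairing
    with something in the row space of \<open>L'\<close> does not see the projection.\<close>
  have proj: "mat_tr (P' * (Y * L' * P'\<^sup>T)) = mat_tr (Y * L')" if Y: "Y \<in> carrier_mat k m'" for Y
  proof -
    have "mat_tr (P' * (Y * L' * P'\<^sup>T)) = mat_tr ((Y * L' * P'\<^sup>T) * P')"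
      by (rule mat_tr_comm[of _ m' k]) (use P'(1) L' Y in auto)
    also have "(Y * L' * P'\<^sup>T) * P' = Y * (L' * (P'\<^sup>T * P'))"
      using P'(1) L' Y by (simp add: mat_assoc del: assoc_mult_mat)
    finally show ?thesis unfolding P'(4) .
  qed
  have LT: "L\<^sup>T \<in> carrier_mat k m" and LT': "L'\<^sup>T \<in> carrier_mat k m'" using L L' by auto
  have B: "P' * L\<^sup>T \<in> carrier_mat m' m" and B': "P' * L'\<^sup>T \<in> carrier_mat m' m'"
    using P'(1) L L' by auto
  have t1: "P' * L\<^sup>T * F * (P' * L\<^sup>T)\<^sup>T = P' * U * P'\<^sup>T"
    and t2: "P' * L\<^sup>T * G * (P' * L'\<^sup>T)\<^sup>T = P' * ((L\<^sup>T * G) * L' * P'\<^sup>T)"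
    and t3: "P' * L'\<^sup>T * F' * (P' * L'\<^sup>T)\<^sup>T = P' * ((L'\<^sup>T * F') * L' * P'\<^sup>T)"
    unfolding U_def using P'(1) L L' F G F'
    by (simp_all add: mat_transpose_mult mat_assoc del: assoc_mult_mat)
  have c: "L\<^sup>T * G \<in> carrier_mat k m'" "L'\<^sup>T * F' \<in> carrier_mat k m'" using L L' G F' by auto
  \<comment> \<open>The expected squared error between the coordinates of \<open>u\<close> and
    \<open>u'\<close> in the row space of \<open>L'\<close>. By \<open>proj\<close> it differs from
    the full error only in its first term, the trace of \<open>U\<close>.\<close>
  have "0 \<le> integral\<^sup>L M (\<lambda>x. \<Sum>j<m'. ((P' * L\<^sup>T *\<^sub>v f x) $ j - (P' * L'\<^sup>T *\<^sub>v f' x) $ j)\<^sup>2)"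
    by (intro integral_nonneg_AE AE_I2 sum_nonneg) auto
  also have "\<dots> = mat_tr (P' * U * P'\<^sup>T) - 2 * mat_tr (L\<^sup>T * G * L') + mat_tr (L'\<^sup>T * F' * L')"
    unfolding integral_dist_linear_images[OF model model' B B', folded F_def G_def F'_def]
      t1 t2 t3 proj[OF c(1)] proj[OF c(2)] ..
  finally have nonneg: "0 \<le> mat_tr (P' * U * P'\<^sup>T) - 2 * mat_tr (L\<^sup>T * G * L') + mat_tr (L'\<^sup>T * F' * L')" .
  have total: "integral\<^sup>L M (\<lambda>x. \<Sum>j<k. ((L\<^sup>T *\<^sub>v f x) $ j - (L'\<^sup>T *\<^sub>v f' x) $ j)\<^sup>2)
    = mat_tr U - 2 * mat_tr (L\<^sup>T * G * L') + mat_tr (L'\<^sup>T * F' * L')"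
    unfolding integral_dist_linear_images[OF model model' LT LT', folded F_def G_def F'_def] U_def
    by simp
  show ?thesis
    using sing_val_trace_bound[OF A C mk] nonneg
    unfolding total A_eq trAC CC F_def[symmetric] U_def[symmetric] by linarith
qed

text \<open>The root of \<open>F\<close> is built as \<open>F * inv_sqrt F\<close>, so that it
  inverts \<open>inv_sqrt F\<close> by construction and the roots of \<open>F\<close> and of its
  inverse need not be compared.\<close>

lemma whitening_factor:
  assumes F: "F \<in> carrier_mat m m" and psd: "psd_mat F" and rank: "vec_space.rank m F = m"
  obtains S where "S \<in> carrier_mat m m" "S\<^sup>T = S" "S * S = F" "inv_sqrt F * S = 1\<^sub>m m" "S * inv_sqrt F = 1\<^sub>m m"
proof -
  have "det F \<noteq> 0" using vec_space.det_rank_iff[OF F] rank by simp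
  define R where "R = inv_sqrt F"
  note R = inv_sqrt_psd[OF F psd \<open>det F \<noteq> 0\<close>, folded R_def]
  have symF: "F\<^sup>T = F" using psd unfolding psd_mat_def sym_mat_def by simp
  define S where "S = F * R"
  have S: "S \<in> carrier_mat m m" unfolding S_def using F R(1) by simp
  have RS: "R * S = 1\<^sub>m m" using R(1,3) F unfolding S_def by (simp add: mat_assoc)
  have SR: "S * R = 1\<^sub>m m" by (rule mat_mult_left_right_inverse[OF R(1) S RS])
  \<comment> \<open>Multiplying by \<open>S\<close> on the left gives \<open>R * F = S\<close>, so
    \<open>R\<close> commutes with \<open>F\<close>; both the square and the symmetry of
    \<open>S\<close> rest on this.\<close>
  have "R * (R * F) = 1\<^sub>m m" using R(1,4) F by (simp add: mat_assoc)
  then have "S * (R * (R * F)) = S" using S by simp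
  then have RF: "R * F = S" using mat_cancel_left[OF SR, of "R * F"] S R(1) F by simp
  have "S * (R * F) = F" by (rule mat_cancel_left[OF SR]) (use S R(1) F in auto)
  then have "S * S = F" unfolding RF .
  moreover have "S\<^sup>T = S"
    using RF R(1,2) F symF by (subst S_def) (simp add: mat_transpose_mult)
  ultimately show ?thesis using that S RS SR unfolding R_def by blast
qed

text \<open>In the whitened coordinates \<open>R f\<close> and \<open>R' f'\<close>, the
  coefficients of \<open>u\<close> and \<open>u'\<close> are \<open>C\<close> and \<open>C'\<close>,
  and \<open>A\<close> is the cross moment. Hence \<open>A\<^sup>T * C\<close> holds the
  coefficients of the L2-projection of \<open>u\<close> onto the span of the components of
  \<open>f'\<close>.\<close>

lemma embedding_similarity_bound:
  fixes f f' :: "'a \<Rightarrow> real vec"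
  assumes model: "is_model M m k f L" and model': "is_model M m' k f' L'" and mk: "m \<le> k"
    and rank: "vec_space.rank m (moment_mat M m m f f) = m"
    and rank': "vec_space.rank m' (moment_mat M m' m' f' f') = m'"
  shows "(\<Sum>i<m. (1 - (sing_val (inv_sqrt (moment_mat M m m f f) * moment_mat M m m' f f'
            * inv_sqrt (moment_mat M m' m' f' f')) i)\<^sup>2)
        * eigvals_desc (L\<^sup>T * moment_mat M m m f f * L) ! i)
    \<le> integral\<^sup>L M (\<lambda>x. \<Sum>j<k. ((L\<^sup>T *\<^sub>v f x) $ j - (L'\<^sup>T *\<^sub>v f' x) $ j)\<^sup>2)"
proof -
  define F G F' where "F = moment_mat M m m f f" and "G = moment_mat M m m' f f'"
    and "F' = moment_mat M m' m' f' f'"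
  have F: "F \<in> carrier_mat m m" and G: "G \<in> carrier_mat m m'" and F': "F' \<in> carrier_mat m' m'"
    unfolding F_def G_def F'_def by auto
  have L: "L \<in> carrier_mat m k" and L': "L' \<in> carrier_mat m' k"
    using model model' unfolding is_model_def by auto
  obtain S where S: "S \<in> carrier_mat m m" "S\<^sup>T = S" "S * S = F" and SR: "S * inv_sqrt F = 1\<^sub>m m"
    using whitening_factor[OF F moment_mat_psd[OF model, folded F_def] rank[folded F_def]] by metis
  obtain S' where S': "S' \<in> carrier_mat m' m'" "S'\<^sup>T = S'" "S' * S' = F'"
    and RS': "inv_sqrt F' * S' = 1\<^sub>m m'"
    using whitening_factor[OF F' moment_mat_psd[OF model', folded F'_def] rank'[folded F'_def]] by metis
  define R R' where "R = inv_sqrt F" and "R' = inv_sqrt F'"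
  note SR = SR[folded R_def] and RS' = RS'[folded R'_def]
  have R: "R \<in> carrier_mat m m"
    using inv_sqrt_psd(1)[OF F moment_mat_psd[OF model, folded F_def]]
      vec_space.det_rank_iff[OF F] rank unfolding R_def F_def by simp
  have R': "R' \<in> carrier_mat m' m'"
    using inv_sqrt_psd(1)[OF F' moment_mat_psd[OF model', folded F'_def]]
      vec_space.det_rank_iff[OF F'] rank' unfolding R'_def F'_def by simp
  define A where "A = R * G * R'"
  have A: "A \<in> carrier_mat m m'" unfolding A_def using R R' G by auto
  define C where "C = S * L"
  define C' where "C' = S' * L'"
  have C: "C \<in> carrier_mat m k" and C': "C' \<in> carrier_mat m' k"
    unfolding C_def C'_def using S(1) S'(1) L L' by auto
  have CC: "C\<^sup>T * C = L\<^sup>T * F * L"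
    unfolding C_def S(3)[symmetric] using S(1,2) L
    by (simp add: mat_transpose_mult mat_assoc del: assoc_mult_mat)
  have CC': "C'\<^sup>T * C' = L'\<^sup>T * F' * L'"
    unfolding C'_def S'(3)[symmetric] using S'(1,2) L'
    by (simp add: mat_transpose_mult mat_assoc del: assoc_mult_mat)
  have "(A\<^sup>T * C)\<^sup>T * C' = L\<^sup>T * (S * (R * (G * (R' * (S' * L')))))"
    unfolding A_def C_def C'_def using S(1,2) S'(1) L L' R R' G
    by (simp add: mat_transpose_mult mat_assoc del: assoc_mult_mat)
  also have "\<dots> = L\<^sup>T * G * L'"
    using S(1) S'(1) L L' R R' G
    by (simp add: mat_cancel_left[OF SR] mat_cancel_left[OF RS'] mat_assoc del: assoc_mult_mat)
  finally have ACC: "(A\<^sup>T * C)\<^sup>T * C' = L\<^sup>T * G * L'" .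
  have AC: "A\<^sup>T * C \<in> carrier_mat m' k" using A C by auto
  have LT: "L\<^sup>T \<in> carrier_mat k m" and LT': "L'\<^sup>T \<in> carrier_mat k m'" using L L' by auto
  have total: "integral\<^sup>L M (\<lambda>x. \<Sum>j<k. ((L\<^sup>T *\<^sub>v f x) $ j - (L'\<^sup>T *\<^sub>v f' x) $ j)\<^sup>2)
    = mat_tr (C\<^sup>T * C) - 2 * mat_tr ((A\<^sup>T * C)\<^sup>T * C') + mat_tr (C'\<^sup>T * C')"
    unfolding integral_dist_linear_images[OF model model' LT LT', folded F_def G_def F'_def] CC CC' ACC
    by simp
  \<comment> \<open>The squared distance from the projection of \<open>u\<close> to
    \<open>u'\<close>; adding the squared distance from \<open>u\<close> to its projection gives
    \<open>total\<close>.\<close>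
  have "0 \<le> mat_tr ((A\<^sup>T * C - C')\<^sup>T * (A\<^sup>T * C - C'))" by (rule mat_tr_gram_nonneg)
  also have "\<dots> = mat_tr ((A\<^sup>T * C)\<^sup>T * (A\<^sup>T * C)) - 2 * mat_tr ((A\<^sup>T * C)\<^sup>T * C') + mat_tr (C'\<^sup>T * C')"
    by (rule mat_tr_gram_diff[OF AC C'])
  finally show ?thesis
    using sing_val_trace_bound[OF A C mk]
    unfolding total F_def[symmetric] G_def[symmetric] F'_def[symmetric]
      R_def[symmetric] R'_def[symmetric] A_def[symmetric] CC[symmetric] by linarith
qed

theorem mainTheorem3:
  fixes M :: "'a measure" and m m' k :: nat
    and f f' :: "'a \<Rightarrow> real vec" and L L' :: "real mat"
  assumes prob: "prob_space M"
    and model: "is_model M m k f L"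
    and model': "is_model M m' k f' L'"
    and rank_Mff: "vec_space.rank m (moment_mat M m m f f) = m"
    and rank_L: "vec_space.rank m L = m"
    and rank_Mff': "vec_space.rank m' (moment_mat M m' m' f' f') = m'"
    and rank_L': "vec_space.rank m' L' = m'"
  defines "u \<equiv> logits L f" and "u' \<equiv> logits L' f'"
  defines "\<mu> \<equiv> (\<lambda>i. eigvals_desc (moment_mat M k k u u) ! i)"
  defines "\<rho> \<equiv> sing_val (inv_sqrt (L * L\<^sup>T) * L * L'\<^sup>T * inv_sqrt (L' * L'\<^sup>T))"
  defines "\<rho>t \<equiv> sing_val (inv_sqrt (moment_mat M m m f f) * moment_mat M m m' f f'
                             * inv_sqrt (moment_mat M m' m' f' f'))"
  shows "(\<Sum>i<m. (1 - (\<rho> i)\<^sup>2) * \<mu> i) \<le> integral\<^sup>L M (\<lambda>x. (\<Sum>j<k. (u x $ j - u' x $ j)\<^sup>2))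
       \<and> (\<Sum>i<m. (1 - (\<rho>t i)\<^sup>2) * \<mu> i) \<le> integral\<^sup>L M (\<lambda>x. (\<Sum>j<k. (u x $ j - u' x $ j)\<^sup>2))"
proof -
  have L: "L \<in> carrier_mat m k" using model unfolding is_model_def by auto
  then have LT: "L\<^sup>T \<in> carrier_mat k m" by simp
  \<comment> \<open>Guarantees that all indices below \<open>m\<close> are genuine positions in the
    list of \<open>k\<close> eigenvalues.\<close>
  have mk: "m \<le> k" using vec_space.rank_le_nc[OF L] rank_L by simp
  have "moment_mat M k k u u = L\<^sup>T * moment_mat M m m f f * L"
    using moment_mat_linear_images[OF model model LT LT] unfolding u_def logits_def by simp
  then show ?thesis
    using unembedding_similarity_bound[OF model model' rank_L rank_L']
      embedding_similarity_bound[OF model model' mk rank_Mff rank_Mff']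
    unfolding \<mu>_def \<rho>_def \<rho>t_def u_def u'_def logits_def by simp
qed


end
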